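(* Let $[n]=I\sqcup O$ and let $f\in\mathcal R_{n,O}$ be a regular subtype. For $i\in I$ and $j\in O$, we have $i\not\rightsquigarrow_f j$ (there is no signalling from $i$ to $j$ in $f$) if and only if $f(e^{i,j})=0$, where $e^{i,j}\in\{0,1\}^n$ is the string with $e^{i,j}_l=1$ iff $l\in\{i,j\}$.
   Context: Notation. $[n]=\{1,\dots,n\}$; $\theta=\theta_n\in\{0,1\}^n$ is the zero string. $\mathcal F_n=\{f:\{0,1\}^n\to\{0,1\} : f(\theta)=1\}$ is a Boolean algebra for the pointwise order, with $\vee,\wedge$ the pointwise maximum/minimum; $p_n$ is the indicator function of $\{\theta\}$, $1_n$ is the constant function $1$, and the complement is $f^*=1-f+p_n$. For $f\in\mathcal F_m$, $g\in\mathcal F_n$, $(f\otimes g)(s^1s^2)=f(s^1)g(s^2)$, where $s^1\in\{0,1\}^m$, $s^2\in\{0,1\}^n$ and $s^1s^2$ is the concatenation. A permutation $\sigma$ of $[n]$ acts on strings by $\sigma(s)=s_{\sigma^{-1}(1)}\dots s_{\sigma^{-1}(n)}$, and $f\circ\sigma$ is the composition. With $e^i_j=\delta_{i,j}$, put $I_f=\{i: f(e^i)=0\}$, $O_f=\{j: f(e^j)=1\}$. Type functions and regular subtypes. The sets $\mathcal T_n\subseteq\mathcal F_n$ ($n\ge1$) of type functions form the smallest family with $1_1\in\mathcal T_1$ closed under $f\mapsto f^*$, $f\mapsto f\circ\sigma$ (all permutations), and $(f,g)\mapsto f\otimes g$. $\mathcal T_{n,O}=\{f\in\mathcal T_n: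 O_f=O\}$, and $\mathcal R_{n,O}$ is the sublattice of $\mathcal F_n$ generated by $\mathcal T_{n,O}$; its elements are the regular subtypes with outputs in $O$ (every such $f$ has $O_f=O$, $I_f=I:=[n]\setminus O$). The sets $T_1(f)$. Let $A_1,\dots,A_n$ be nontrivial elementary types, i.e. quantum systems with finite-dimensional complex Hilbert spaces $\mathcal H_{A_i}$ of dimension $\ge2$; $\mathcal H=\bigotimes_{i=1}^n\mathcal H_{A_i}$, $\mathcal H_T=\bigotimes_{i\in T}\mathcal H_{A_i}$ for $T\subseteq[n]$ ($\mathcal H_\emptyset=\mathbb C$). Let $L_{i,0}=\mathbb R I_{\mathcal H_{A_i}}$ and $L_{i,1}$ the traceless Hermitian operators on $\mathcal H_{A_i}$; for $s\in\{0,1\}^n$ put $L_s=L_{1,s_1}\otimes\dots\otimes L_{n,s_n}$, and $S_f=\bigoplus_{s: f(s)=1}L_s$. Then $T_1(f)=\{C\in S_f: C\ge0,\ \mathrm{Tr}[C]=\prod_{i\in I_f}\dim\mathcal H_{A_i}\}$. Signalling. Let $\Phi:B(\mathcal H_I)\to B(\mathcal H_O)$ be a channel (completely positive trace preserving map) with Choi operator $C_\Phi=\sum_{k,l}|k\rangle\langle l|\otimes\Phi(|k\rangle\langle l|)$ for an orthonormal basis of $\mathcal H_I$, regarded as an operator on $\mathcal H\cong\mathcal H_I\otimes\mathcal H_O$ after reordering factors. There is no signalling from $i\in I$ to $j\in O$ in $\Phi$, written $i\not\rightsquigarrow_\Phi j$, if $\mathrm{Tr}_{O\setminus\{j\}}[C_\Phi]=I_{\mathcal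 H_{A_i}}\otimes C_{\Phi_1}$ for some channel $\Phi_1:B(\mathcal H_{I\setminus\{i\}})\to B(\mathcal H_{A_j})$, where $\mathrm{Tr}_{O\setminus\{j\}}$ is the partial trace over $\mathcal H_{O\setminus\{j\}}$. For $f\in\mathcal R_{n,O}$, $i\not\rightsquigarrow_f j$ means that $i\not\rightsquigarrow_\Phi j$ for every choice of nontrivial elementary types $A_1,\dots,A_n$ and every channel $\Phi$ with $C_\Phi\in T_1(f)$. *)

theory Defs
  imports
    "HOL-Analysis.Finite_Product_Measure"
    "HOL-Combinatorics.Permutations"
    "HOL-Library.Function_Algebras"
begin

section \<open>Boolean functions and type functions\<close>

text \<open>
  The index set $[n]$ is rendered as \<open>{..<n}\<close>, so positions are numbered from 0 as in the list
  library. The bits 0 and 1 are \<open>False\<close> and \<open>True\<close>, both for the entries of a string and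
  for the values of a function. A function on $\{0,1\}^n$ is extended by \<open>False\<close> to lists
  of other lengths; join and meet are then \<open>sup\<close> and \<open>inf\<close> of the function type.
\<close>

type_synonym bstring = "bool list"
type_synonym bfun = "bstring \<Rightarrow> bool"

definition strings :: "nat \<Rightarrow> bstring set" where
  "strings n = {s. length s = n}"

definition zero_string :: "nat \<Rightarrow> bstring" where
  "zero_string n = replicate n False"

definition indicator_string :: "nat \<Rightarrow> nat set \<Rightarrow> bstring" where
  "indicator_string n A = map (\<lambda>l. l \<in> A) [0..<n]"

definition bool_funs :: "nat \<Rightarrow> bfun set" where
  "bool_funs n = {f. (\<forall>s. f s \<longrightarrow> s \<in> strings n) \<and> f (zero_string n)}"

definition one_fun :: "nat \<Rightarrow> bfun" where
  "one_fun n = (\<lambda>s. s \<in> strings n)"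

text \<open>In $f^* = 1 - f + p_n$ the term $p_n$ only matters at $\theta$, where $f(\theta) = 1$.\<close>

definition compl_fun :: "nat \<Rightarrow> bfun \<Rightarrow> bfun" where
  "compl_fun n f = (\<lambda>s. s \<in> strings n \<and> (\<not> f s \<or> s = zero_string n))"

definition tensor_fun :: "nat \<Rightarrow> nat \<Rightarrow> bfun \<Rightarrow> bfun \<Rightarrow> bfun" where
  "tensor_fun m n f g = (\<lambda>s. s \<in> strings (m + n) \<and> f (take m s) \<and> g (drop m s))"

definition perm_string :: "(nat \<Rightarrow> nat) \<Rightarrow> bstring \<Rightarrow> bstring" where
  "perm_string \<sigma> s = permute_list (inv \<sigma>) s"

definition input_set :: "nat \<Rightarrow> bfun \<Rightarrow> nat set" where
  "input_set n f = {i. i < n \<and> \<not> f (indicator_string n {i})}"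

definition output_set :: "nat \<Rightarrow> bfun \<Rightarrow> nat set" where
  "output_set n f = {j. j < n \<and> f (indicator_string n {j})}"

inductive type_fun :: "nat \<Rightarrow> bfun \<Rightarrow> bool" where
  one: "type_fun 1 (one_fun 1)"
| compl: "type_fun n f \<Longrightarrow> type_fun n (compl_fun n f)"
| perm: "type_fun n f \<Longrightarrow> \<sigma> permutes {..<n} \<Longrightarrow> type_fun n (f \<circ> perm_string \<sigma>)"
| tensor: "type_fun m f \<Longrightarrow> type_fun n g \<Longrightarrow> type_fun (m + n) (tensor_fun m n f g)"

definition type_funs_with_outputs :: "nat \<Rightarrow> nat set \<Rightarrow> bfun set" where
  "type_funs_with_outputs n Out = {f. type_fun n f \<and> output_set n f = Out}"

text \<open>The sublattice $\mathcal R_{n,O}$ generated by $\mathcal T_{n,O}$.\<close>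

inductive_set regular_subtypes :: "nat \<Rightarrow> nat set \<Rightarrow> bfun set"
  for n :: nat and Out :: "nat set" where
  type: "f \<in> type_funs_with_outputs n Out \<Longrightarrow> f \<in> regular_subtypes n Out"
| join: "f \<in> regular_subtypes n Out \<Longrightarrow> g \<in> regular_subtypes n Out \<Longrightarrow> sup f g \<in> regular_subtypes n Out"
| meet: "f \<in> regular_subtypes n Out \<Longrightarrow> g \<in> regular_subtypes n Out \<Longrightarrow> inf f g \<in> regular_subtypes n Out"

lemma type_fun_in_bool_funs: "type_fun n f \<Longrightarrow> f \<in> bool_funs n"
proof (induction rule: type_fun.induct)
  case (perm n f \<sigma>)
  then have inv: "inv \<sigma> permutes {..<n}" by (simp add: permutes_inv)
  have "perm_string \<sigma> (zero_string n) = zero_string n"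
  proof (rule nth_equalityI)
    fix k assume "k < length (perm_string \<sigma> (zero_string n))"
    then have "k < n" by (simp add: perm_string_def zero_string_def)
    moreover from this have "inv \<sigma> k < n" using permutes_in_image[OF inv, of k] by simp
    ultimately show "perm_string \<sigma> (zero_string n) ! k = zero_string n ! k"
      by (simp add: perm_string_def zero_string_def permute_list_def)
  qed (simp add: perm_string_def zero_string_def)
  with perm show ?case by (auto simp: bool_funs_def strings_def perm_string_def)
qed (auto simp: bool_funs_def one_fun_def compl_fun_def tensor_fun_def strings_def
    zero_string_def)

lemma regular_subtypes_in_bool_funs: "f \<in> regular_subtypes n Out \<Longrightarrow> f \<in> bool_funs n"
  by (induction rule: regular_subtypes.induct)
    (auto simp: type_funs_with_outputs_def bool_funs_def dest!: type_fun_in_bool_funs)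

lemma regular_subtypes_output_set: "f \<in> regular_subtypes n Out \<Longrightarrow> output_set n f = Out"
  by (induction rule: regular_subtypes.induct)
    (auto simp: type_funs_with_outputs_def output_set_def)

lemma regular_subtypes_input_set: "f \<in> regular_subtypes n Out \<Longrightarrow> input_set n f = {..<n} - Out"
  using regular_subtypes_output_set[of f n Out] by (auto simp: input_set_def output_set_def)


section \<open>Operators on multipartite systems\<close>

text \<open>
  An elementary system $A_i$ of dimension \<open>d i\<close> has Hilbert space $\mathbb C^{d_i}$ with its
  standard basis. For a finite \<open>T\<close>, the product basis of $\mathcal H_T$ is indexed by the
  functions in \<open>basis d T\<close>, so a tensor product of disjoint systems comes without an ordering of
  the factors. An operator on $\mathcal H_T$ is its matrix in the product basis, extended by 0.
  For \<open>T = {}\<close> the basis has exactly one element, so $\mathcal H_\emptyset = \mathbb C$.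
\<close>

type_synonym mindex = "nat \<Rightarrow> nat"
type_synonym oper = "mindex \<Rightarrow> mindex \<Rightarrow> complex"

definition basis :: "(nat \<Rightarrow> nat) \<Rightarrow> nat set \<Rightarrow> mindex set" where
  "basis d T = (\<Pi>\<^sub>E i\<in>T. {..<d i})"

definition opers :: "(nat \<Rightarrow> nat) \<Rightarrow> nat set \<Rightarrow> oper set" where
  "opers d T = {X. \<forall>a b. X a b \<noteq> 0 \<longrightarrow> a \<in> basis d T \<and> b \<in> basis d T}"

definition id_oper :: "(nat \<Rightarrow> nat) \<Rightarrow> nat set \<Rightarrow> oper" where
  "id_oper d T = (\<lambda>a b. if a \<in> basis d T \<and> a = b then 1 else 0)"

definition ketbra :: "mindex \<Rightarrow> mindex \<Rightarrow> oper" where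
  "ketbra k l = (\<lambda>a b. if a = k \<and> b = l then 1 else 0)"

definition hermitian :: "oper \<Rightarrow> bool" where
  "hermitian X \<longleftrightarrow> (\<forall>a b. X b a = cnj (X a b))"

definition trace :: "(nat \<Rightarrow> nat) \<Rightarrow> nat set \<Rightarrow> oper \<Rightarrow> complex" where
  "trace d T X = (\<Sum>a\<in>basis d T. X a a)"

definition tensor :: "(nat \<Rightarrow> nat) \<Rightarrow> nat set \<Rightarrow> nat set \<Rightarrow> oper \<Rightarrow> oper \<Rightarrow> oper" where
  "tensor d T U X Y = (\<lambda>a b. if a \<in> basis d (T \<union> U) \<and> b \<in> basis d (T \<union> U)
     then X (restrict a T) (restrict b T) * Y (restrict a U) (restrict b U) else 0)"

definition tensor_family :: "(nat \<Rightarrow> nat) \<Rightarrow> nat set \<Rightarrow> (nat \<Rightarrow> oper) \<Rightarrow> oper" where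
  "tensor_family d T X = (\<lambda>a b. if a \<in> basis d T \<and> b \<in> basis d T
     then (\<Prod>i\<in>T. X i (restrict a {i}) (restrict b {i})) else 0)"

text \<open>\<open>ptrace d T U\<close> traces out $\mathcal H_U$ and leaves an operator on $\mathcal H_T$,
  for disjoint \<open>T\<close> and \<open>U\<close>.\<close>

definition ptrace :: "(nat \<Rightarrow> nat) \<Rightarrow> nat set \<Rightarrow> nat set \<Rightarrow> oper \<Rightarrow> oper" where
  "ptrace d T U X = (\<lambda>a b. if a \<in> basis d T \<and> b \<in> basis d T
     then (\<Sum>c\<in>basis d U. X (merge T U (a, c)) (merge T U (b, c))) else 0)"

text \<open>Positive semidefiniteness of a complex matrix indexed by the finite set \<open>A\<close>.\<close>

definition psd :: "'a set \<Rightarrow> ('a \<Rightarrow> 'a \<Rightarrow> complex) \<Rightarrow> bool" where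
  "psd A K \<longleftrightarrow> (\<forall>v :: 'a \<Rightarrow> complex.
     let q = (\<Sum>x\<in>A. \<Sum>y\<in>A. cnj (v x) * K x y * v y) in q \<in> \<real> \<and> 0 \<le> Re q)"


section \<open>The sets of Choi operators belonging to a Boolean function\<close>

definition oper_scaleR :: "real \<Rightarrow> oper \<Rightarrow> oper" where
  "oper_scaleR r X = (\<lambda>a b. of_real r * X a b)"

interpretation oper: vector_space oper_scaleR
  by unfold_locales (auto simp: oper_scaleR_def fun_eq_iff algebra_simps)

definition local_space :: "(nat \<Rightarrow> nat) \<Rightarrow> nat \<Rightarrow> bool \<Rightarrow> oper set" where
  "local_space d i c =
     (if c then {X \<in> opers d {i}. hermitian X \<and> trace d {i} X = 0}
      else range (\<lambda>r. oper_scaleR r (id_oper d {i})))"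

text \<open>A tensor product of real subspaces is the real span of the product operators.\<close>

definition string_space :: "(nat \<Rightarrow> nat) \<Rightarrow> bstring \<Rightarrow> oper set" where
  "string_space d s =
     oper.span {tensor_family d {..<length s} X | X. \<forall>i<length s. X i \<in> local_space d i (s ! i)}"

definition fun_space :: "(nat \<Rightarrow> nat) \<Rightarrow> nat \<Rightarrow> bfun \<Rightarrow> oper set" where
  "fun_space d n f = {\<Sum>s | s \<in> strings n \<and> f s. X s | X.
     \<forall>s. s \<in> strings n \<and> f s \<longrightarrow> X s \<in> string_space d s}"

definition T1 :: "(nat \<Rightarrow> nat) \<Rightarrow> nat \<Rightarrow> bfun \<Rightarrow> oper set" where
  "T1 d n f = {C \<in> fun_space d n f. psd (basis d {..<n}) C \<and>
     trace d {..<n} C = of_nat (\<Prod>i\<in>input_set n f. d i)}"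


section \<open>Channels and signalling\<close>

text \<open>A map between operator algebras is only relevant on \<open>opers d T\<close>.\<close>

definition linear_map ::
    "(nat \<Rightarrow> nat) \<Rightarrow> nat set \<Rightarrow> nat set \<Rightarrow> (oper \<Rightarrow> oper) \<Rightarrow> bool" where
  "linear_map d T U \<Phi> \<longleftrightarrow>
     (\<forall>X\<in>opers d T. \<Phi> X \<in> opers d U) \<and>
     (\<forall>X\<in>opers d T. \<forall>Y\<in>opers d T. \<Phi> (X + Y) = \<Phi> X + \<Phi> Y) \<and>
     (\<forall>c. \<forall>X\<in>opers d T. \<Phi> (\<lambda>a b. c * X a b) = (\<lambda>a b. c * \<Phi> X a b))"

text \<open>
  $\mathrm{id}_k \otimes \Phi$ is positive for every $k$; an operator on
  $\mathbb C^k \otimes \mathcal H_T$ is given by its $k \times k$ matrix \<open>X\<close> of operators on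
  $\mathcal H_T$.
\<close>

definition completely_positive ::
    "(nat \<Rightarrow> nat) \<Rightarrow> nat set \<Rightarrow> nat set \<Rightarrow> (oper \<Rightarrow> oper) \<Rightarrow> bool" where
  "completely_positive d T U \<Phi> \<longleftrightarrow>
     (\<forall>k :: nat. \<forall>X :: nat \<Rightarrow> nat \<Rightarrow> oper.
        (\<forall>p<k. \<forall>q<k. X p q \<in> opers d T) \<and>
        psd ({..<k} \<times> basis d T) (\<lambda>(p, a) (q, b). X p q a b) \<longrightarrow>
        psd ({..<k} \<times> basis d U) (\<lambda>(p, a) (q, b). \<Phi> (X p q) a b))"

definition trace_preserving ::
    "(nat \<Rightarrow> nat) \<Rightarrow> nat set \<Rightarrow> nat set \<Rightarrow> (oper \<Rightarrow> oper) \<Rightarrow> bool" where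
  "trace_preserving d T U \<Phi> \<longleftrightarrow> (\<forall>X\<in>opers d T. trace d U (\<Phi> X) = trace d T X)"

definition channel ::
    "(nat \<Rightarrow> nat) \<Rightarrow> nat set \<Rightarrow> nat set \<Rightarrow> (oper \<Rightarrow> oper) \<Rightarrow> bool" where
  "channel d T U \<Phi> \<longleftrightarrow>
     linear_map d T U \<Phi> \<and> completely_positive d T U \<Phi> \<and> trace_preserving d T U \<Phi>"

definition choi ::
    "(nat \<Rightarrow> nat) \<Rightarrow> nat set \<Rightarrow> nat set \<Rightarrow> (oper \<Rightarrow> oper) \<Rightarrow> oper" where
  "choi d T U \<Phi> = (\<Sum>k\<in>basis d T. \<Sum>l\<in>basis d T. tensor d T U (ketbra k l) (\<Phi> (ketbra k l)))"

definition no_signalling_channel ::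
    "(nat \<Rightarrow> nat) \<Rightarrow> nat set \<Rightarrow> nat set \<Rightarrow> (oper \<Rightarrow> oper) \<Rightarrow> nat \<Rightarrow> nat \<Rightarrow> bool" where
  "no_signalling_channel d Inp Out \<Phi> i j \<longleftrightarrow>
     (\<exists>\<Phi>\<^sub>1. channel d (Inp - {i}) {j} \<Phi>\<^sub>1 \<and>
        ptrace d (Inp \<union> {j}) (Out - {j}) (choi d Inp Out \<Phi>) =
          tensor d {i} ((Inp - {i}) \<union> {j}) (id_oper d {i}) (choi d (Inp - {i}) {j} \<Phi>\<^sub>1))"

definition no_signalling :: "nat \<Rightarrow> nat set \<Rightarrow> nat set \<Rightarrow> bfun \<Rightarrow> nat \<Rightarrow> nat \<Rightarrow> bool" where
  "no_signalling n Inp Out f i j \<longleftrightarrow>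
     (\<forall>d \<Phi>. (\<forall>l<n. 2 \<le> d l) \<and> channel d Inp Out \<Phi> \<and> choi d Inp Out \<Phi> \<in> T1 d n f \<longrightarrow>
        no_signalling_channel d Inp Out \<Phi> i j)"

end

theory Submission
  imports Defs
begin

text \<open>
  If $C \in S_f$, the partial trace over $O \setminus \{j\}$ kills every component $L_s$ with
  $s_l = 1$ for some $l \in O \setminus \{j\}$. A surviving component that is not a multiple of
  the identity on $A_i$ has $s_i = 1$, and for regular subtypes $f(s) = 1$ then forces $s_j = 1$
  and $f(e^{i,j}) = 1$. So if $f(e^{i,j}) = 0$ the partial trace is an identity on $A_i$ tensored
  with a Choi operator; the channel $\Phi_1$ is obtained by feeding the state $|0\rangle\langle 0|$
  into $A_i$. Conversely, if $f(e^{i,j}) = 1$, then on qubits the operator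
  $2^{-|O|} (1 + Z_i Z_j)$ belongs to $T_1(f)$ and is the Choi operator of a classical channel in
  which the bit $j$ is a copy of the bit $i$.
\<close>

section \<open>Restrictions on the values of regular subtypes\<close>

text \<open>On the combinatorial side the obstacle is complementation: it exchanges inputs and
  outputs, so a property tied to a fixed output set does not survive the induction over type
  functions. \<open>balanced\<close> therefore speaks of inputs and outputs only through values on
  singletons, with a string replaced by the set of positions where it is 1. Once the output set is
  fixed, what is needed has the form "\<open>f s\<close> implies a condition on \<open>s\<close>" or
  "\<open>f s\<close> implies that \<open>f\<close> holds at the pair", and both forms pass through
  joins and meets.

  On the operator side, no signalling asks for a channel, not merely for a factorisation of an
  operator. Since the candidate is a composite of channels, complete positivity never has to be read
  back from a Choi operator. Being an identity on $A_i$ is expressed by matrix entries; this is a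
  linear condition, so product operators suffice as test cases.

  In the converse, the constant makes the rows of a stochastic matrix sum to 1, and the two summands
  lie in the components of \<theta> and $e^{i,j}$, where \<open>f\<close> is 1.\<close>

text \<open>
  Only the second and fourth clauses are needed below; the third and fifth are their duals under
  complementation, without which the induction over type functions does not go through.
\<close>

definition balanced :: "nat set \<Rightarrow> (nat set \<Rightarrow> bool) \<Rightarrow> bool" where
  "balanced U F \<longleftrightarrow> F {} \<and>
     (\<forall>A\<subseteq>U. F A \<and> A \<noteq> {} \<longrightarrow> (\<exists>j\<in>A. F {j})) \<and>
     (\<forall>A\<subseteq>U. \<not> F A \<longrightarrow> (\<exists>i\<in>A. \<not> F {i})) \<and>
     (\<forall>A\<subseteq>U. \<forall>i\<in>A. \<forall>j\<in>A. F A \<and> \<not> F {i} \<and> F {j} \<and> (\<forall>k\<in>A. F {k} \<longrightarrow> k = j) \<longrightarrow> F {i, j}) \<and>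
     (\<forall>A\<subseteq>U. \<forall>i\<in>A. \<forall>j\<in>A. F {i, j} \<and> \<not> F {i} \<and> F {j} \<and> (\<forall>k\<in>A. \<not> F {k} \<longrightarrow> k = i) \<longrightarrow> F A)"

lemma balancedD:
  assumes "balanced U F"
  shows "F {}"
    and "A \<subseteq> U \<Longrightarrow> F A \<Longrightarrow> A \<noteq> {} \<Longrightarrow> \<exists>j\<in>A. F {j}"
    and "A \<subseteq> U \<Longrightarrow> \<not> F A \<Longrightarrow> \<exists>i\<in>A. \<not> F {i}"
    and "A \<subseteq> U \<Longrightarrow> i \<in> A \<Longrightarrow> j \<in> A \<Longrightarrow> F A \<Longrightarrow> \<not> F {i} \<Longrightarrow> F {j} \<Longrightarrow>
      (\<And>k. k \<in> A \<Longrightarrow> F {k} \<Longrightarrow> k = j) \<Longrightarrow> F {i, j}"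
    and "A \<subseteq> U \<Longrightarrow> i \<in> A \<Longrightarrow> j \<in> A \<Longrightarrow> F {i, j} \<Longrightarrow> \<not> F {i} \<Longrightarrow> F {j} \<Longrightarrow>
      (\<And>k. k \<in> A \<Longrightarrow> \<not> F {k} \<Longrightarrow> k = i) \<Longrightarrow> F A"
proof -
  note b = assms[unfolded balanced_def]
  show "F {}" using b by (rule conjunct1)
  note b = b[THEN conjunct2]
  show "\<exists>j\<in>A. F {j}" if "A \<subseteq> U" "F A" "A \<noteq> {}"
    using b[THEN conjunct1] that by simp
  note b = b[THEN conjunct2]
  show "\<exists>i\<in>A. \<not> F {i}" if "A \<subseteq> U" "\<not> F A"
    using b[THEN conjunct1] that by simp
  note b = b[THEN conjunct2]
  show "F {i, j}" if "A \<subseteq> U" "i \<in> A" "j \<in> A" "F A" "\<not> F {i}" "F {j}"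
    "\<And>k. k \<in> A \<Longrightarrow> F {k} \<Longrightarrow> k = j"
    by (rule b[THEN conjunct1, rule_format, of A i j]) (use that in blast)+
  show "F A" if "A \<subseteq> U" "i \<in> A" "j \<in> A" "F {i, j}" "\<not> F {i}" "F {j}"
    "\<And>k. k \<in> A \<Longrightarrow> \<not> F {k} \<Longrightarrow> k = i"
    by (rule b[THEN conjunct2, rule_format, of A i j]) (use that in blast)+
qed

text \<open>Complementation turns input singletons into output singletons and conversely. The second
  clause thus comes from the third and the fourth from the fifth with \<open>i\<close> and
  \<open>j\<close> exchanged, and vice versa. The disjunct \<open>A = {}\<close> reflects that $f^*$
  keeps the value 1 at \<theta>.\<close>

lemma balanced_compl:
  assumes F: "balanced U F"
  shows "balanced U (\<lambda>A. \<not> F A \<or> A = {})"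
  unfolding balanced_def
proof (intro conjI allI ballI impI)
  show "\<not> F {} \<or> {} = ({} :: nat set)" by simp
next
  fix A assume "A \<subseteq> U" "(\<not> F A \<or> A = {}) \<and> A \<noteq> {}"
  then show "\<exists>j\<in>A. \<not> F {j} \<or> {j} = {}" using balancedD(3)[OF F, of A] by blast
next
  fix A assume "A \<subseteq> U" "\<not> (\<not> F A \<or> A = {})"
  then show "\<exists>i\<in>A. \<not> (\<not> F {i} \<or> {i} = {})" using balancedD(2)[OF F, of A] by blast
next
  fix A i j assume A: "A \<subseteq> U" and i: "i \<in> A" and j: "j \<in> A"
    and *: "(\<not> F A \<or> A = {}) \<and> \<not> (\<not> F {i} \<or> {i} = {}) \<and> (\<not> F {j} \<or> {j} = {}) \<and>
      (\<forall>k\<in>A. \<not> F {k} \<or> {k} = {} \<longrightarrow> k = j)"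
  have "\<not> F {j, i}"
    using balancedD(5)[OF F A j i] * i by blast
  then show "\<not> F {i, j} \<or> {i, j} = {}" by (simp add: insert_commute)
next
  fix A i j assume A: "A \<subseteq> U" and i: "i \<in> A" and j: "j \<in> A"
    and *: "(\<not> F {i, j} \<or> {i, j} = {}) \<and> \<not> (\<not> F {i} \<or> {i} = {}) \<and> (\<not> F {j} \<or> {j} = {}) \<and>
      (\<forall>k\<in>A. \<not> (\<not> F {k} \<or> {k} = {}) \<longrightarrow> k = i)"
  have "\<not> F {j, i}" using * by (simp add: insert_commute)
  then have "\<not> F A"
    using balancedD(4)[OF F A j i] * i by blast
  then show "\<not> F A \<or> A = {}" by simp
qed

text \<open>Images of singletons and pairs are singletons and pairs, so every clause pulls back
  along \<open>h\<close>. This covers both relabellings that occur: a permutation of the positions,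
  and the index shift of the second factor of a tensor product.\<close>

lemma balanced_image:
  assumes F: "balanced V F" and "h ` U \<subseteq> V"
  shows "balanced U (\<lambda>A. F (h ` A))"
proof -
  have sub: "h ` A \<subseteq> V" if "A \<subseteq> U" for A using assms(2) that by blast
  show ?thesis
    unfolding balanced_def image_insert image_empty
  proof (intro conjI allI ballI impI)
    show "F {}" using balancedD(1)[OF F] .
  next
    fix A assume "A \<subseteq> U" "F (h ` A) \<and> A \<noteq> {}"
    then show "\<exists>j\<in>A. F {h j}" using balancedD(2)[OF F sub, of A] by blast
  next
    fix A assume "A \<subseteq> U" "\<not> F (h ` A)"
    then show "\<exists>i\<in>A. \<not> F {h i}" using balancedD(3)[OF F sub, of A] by blast
  next
    fix A i j assume A: "A \<subseteq> U" "i \<in> A" "j \<in> A"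
      and *: "F (h ` A) \<and> \<not> F {h i} \<and> F {h j} \<and> (\<forall>k\<in>A. F {h k} \<longrightarrow> k = j)"
    show "F {h i, h j}"
      by (rule balancedD(4)[OF F sub[OF A(1)]]) (use A * in blast)+
  next
    fix A i j assume A: "A \<subseteq> U" "i \<in> A" "j \<in> A"
      and *: "F {h i, h j} \<and> \<not> F {h i} \<and> F {h j} \<and> (\<forall>k\<in>A. \<not> F {h k} \<longrightarrow> k = i)"
    show "F (h ` A)"
      by (rule balancedD(5)[OF F sub[OF A(1)], of "h i" "h j"]) (use A * in blast)+
  qed
qed

text \<open>For the fourth clause: if \<open>A\<close> met both factors, the second clause would
  supply an output in each of them, against the uniqueness of \<open>j\<close>; so \<open>A\<close>
  lies in the factor of \<open>j\<close>. For the fifth: if \<open>i\<close> and \<open>j\<close>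
  lay in different factors, the factor of \<open>i\<close> would see only \<open>{i}\<close>, where
  the value is 0; so they share a factor, and the other one contains no input and has value 1 by the
  third clause.\<close>

lemma balanced_conj:
  assumes F: "balanced U F" and G: "balanced V G" and disj: "U \<inter> V = {}"
  shows "balanced (U \<union> V) (\<lambda>A. F (A \<inter> U) \<and> G (A \<inter> V))"
proof -
  have emp: "F {}" "G {}" using balancedD(1)[OF F] balancedD(1)[OF G] by simp_all
  have sU: "{k} \<inter> U = {k}" "{k} \<inter> V = {}" if "k \<in> U" for k
    using that disj by auto
  have sV: "{k} \<inter> V = {k}" "{k} \<inter> U = {}" if "k \<in> V" for k
    using that disj by auto
  show ?thesis
    unfolding balanced_def
  proof (intro conjI allI ballI impI)
    show "F ({} \<inter> U)" "G ({} \<inter> V)" by (simp_all add: emp)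
  next
    fix A assume A: "A \<subseteq> U \<union> V" "(F (A \<inter> U) \<and> G (A \<inter> V)) \<and> A \<noteq> {}"
    consider "A \<inter> U \<noteq> {}" | "A \<inter> V \<noteq> {}" using A by blast
    then show "\<exists>j\<in>A. F ({j} \<inter> U) \<and> G ({j} \<inter> V)"
    proof cases
      case 1
      then obtain j where "j \<in> A" "j \<in> U" "F {j}"
        using balancedD(2)[OF F, of "A \<inter> U"] A by auto
      then show ?thesis by (intro bexI[of _ j]) (simp_all add: sU emp)
    next
      case 2
      then obtain j where "j \<in> A" "j \<in> V" "G {j}"
        using balancedD(2)[OF G, of "A \<inter> V"] A by auto
      then show ?thesis by (intro bexI[of _ j]) (simp_all add: sV emp)
    qed
  next
    fix A assume A: "A \<subseteq> U \<union> V" "\<not> (F (A \<inter> U) \<and> G (A \<inter> V))"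
    then consider "\<not> F (A \<inter> U)" | "\<not> G (A \<inter> V)" by blast
    then show "\<exists>j\<in>A. \<not> (F ({j} \<inter> U) \<and> G ({j} \<inter> V))"
    proof cases
      case 1
      then obtain j where "j \<in> A" "j \<in> U" "\<not> F {j}"
        using balancedD(3)[OF F, of "A \<inter> U"] A by auto
      then show ?thesis by (intro bexI[of _ j]) (simp_all add: sU emp)
    next
      case 2
      then obtain j where "j \<in> A" "j \<in> V" "\<not> G {j}"
        using balancedD(3)[OF G, of "A \<inter> V"] A by auto
      then show ?thesis by (intro bexI[of _ j]) (simp_all add: sV emp)
    qed
  next
    fix A i j
    assume A: "A \<subseteq> U \<union> V" and ij: "i \<in> A" "j \<in> A" and *: "(F (A \<inter> U) \<and> G (A \<inter> V)) \<and>
        \<not> (F ({i} \<inter> U) \<and> G ({i} \<inter> V)) \<and> (F ({j} \<inter> U) \<and> G ({j} \<inter> V)) \<and>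
        (\<forall>k\<in>A. F ({k} \<inter> U) \<and> G ({k} \<inter> V) \<longrightarrow> k = j)"
    have onlyU: "k = j" if "k \<in> A" "k \<in> U" "F {k}" for k
      using * that by (simp add: sU emp)
    have onlyV: "k = j" if "k \<in> A" "k \<in> V" "G {k}" for k
      using * that by (simp add: sV emp)
    have FG: "F (A \<inter> U)" "G (A \<inter> V)"
      and U: "i \<in> U \<Longrightarrow> \<not> F {i}" "j \<in> U \<Longrightarrow> F {j}"
      and V: "i \<in> V \<Longrightarrow> \<not> G {i}" "j \<in> V \<Longrightarrow> G {j}"
      using * by (simp_all add: sU sV emp)
    consider "j \<in> U" | "j \<in> V" using A ij by blast
    then have "F ({i, j} \<inter> U) \<and> G ({i, j} \<inter> V)"
    proof cases
      case 1
      have "A \<inter> V = {}"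
      proof (rule ccontr)
        assume "A \<inter> V \<noteq> {}"
        then obtain k where "k \<in> A" "k \<in> V" "G {k}"
          using balancedD(2)[OF G, of "A \<inter> V"] FG by blast
        then show False using onlyV[of k] 1 disj by blast
      qed
      then have iU: "i \<in> U" using A ij by blast
      have "F {i, j}"
        by (rule balancedD(4)[OF F Int_lower2 _ _ FG(1) U(1)[OF iU] U(2)[OF 1]])
          (use ij 1 iU in simp, use ij 1 in simp, rule onlyU, simp_all)
      moreover have "{i, j} \<inter> U = {i, j}" "{i, j} \<inter> V = {}" using disj iU 1 by auto
      ultimately show ?thesis by (simp add: emp)
    next
      case 2
      have "A \<inter> U = {}"
      proof (rule ccontr)
        assume "A \<inter> U \<noteq> {}"
        then obtain k where "k \<in> A" "k \<in> U" "F {k}"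
          using balancedD(2)[OF F, of "A \<inter> U"] FG by blast
        then show False using onlyU[of k] 2 disj by blast
      qed
      then have iV: "i \<in> V" using A ij by blast
      have "G {i, j}"
        by (rule balancedD(4)[OF G Int_lower2 _ _ FG(2) V(1)[OF iV] V(2)[OF 2]])
          (use ij 2 iV in simp, use ij 2 in simp, rule onlyV, simp_all)
      moreover have "{i, j} \<inter> V = {i, j}" "{i, j} \<inter> U = {}" using disj iV 2 by auto
      ultimately show ?thesis by (simp add: emp)
    qed
    then show "F ({i, j} \<inter> U)" "G ({i, j} \<inter> V)" by auto
  next
    fix A i j
    assume A: "A \<subseteq> U \<union> V" and ij: "i \<in> A" "j \<in> A"
      and *: "(F ({i, j} \<inter> U) \<and> G ({i, j} \<inter> V)) \<and>
        \<not> (F ({i} \<inter> U) \<and> G ({i} \<inter> V)) \<and> (F ({j} \<inter> U) \<and> G ({j} \<inter> V)) \<and>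
        (\<forall>k\<in>A. \<not> (F ({k} \<inter> U) \<and> G ({k} \<inter> V)) \<longrightarrow> k = i)"
    have onlyU: "k = i" if "k \<in> A" "k \<in> U" "\<not> F {k}" for k
      using * that by (simp add: sU emp)
    have onlyV: "k = i" if "k \<in> A" "k \<in> V" "\<not> G {k}" for k
      using * that by (simp add: sV emp)
    have FG: "F ({i, j} \<inter> U)" "G ({i, j} \<inter> V)"
      and U: "i \<in> U \<Longrightarrow> \<not> F {i}" "j \<in> U \<Longrightarrow> F {j}"
      and V: "i \<in> V \<Longrightarrow> \<not> G {i}" "j \<in> V \<Longrightarrow> G {j}"
      using * by (simp_all add: sU sV emp)
    consider "i \<in> U" | "i \<in> V" using A ij by blast
    then have "F (A \<inter> U) \<and> G (A \<inter> V)"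
    proof cases
      case 1
      have jU: "j \<in> U"
      proof (rule ccontr)
        assume "j \<notin> U"
        then have "{i, j} \<inter> U = {i}" using 1 by blast
        have "F {i}" using FG(1) unfolding \<open>{i, j} \<inter> U = {i}\<close> .
        then show False using U(1) 1 by simp
      qed
      have "G (A \<inter> V)"
      proof (rule ccontr)
        assume "\<not> G (A \<inter> V)"
        then obtain k where "k \<in> A" "k \<in> V" "\<not> G {k}"
          using balancedD(3)[OF G, of "A \<inter> V"] by blast
        then show False using onlyV[of k] 1 disj by blast
      qed
      moreover have ijU: "{i, j} \<inter> U = {i, j}" using 1 jU by blast
      moreover have "F (A \<inter> U)"
        by (rule balancedD(5)[OF F Int_lower2 _ _ FG(1)[unfolded ijU] U(1)[OF 1] U(2)[OF jU]])
          (use ij 1 in simp, use ij jU in simp, rule onlyU, simp_all)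
      ultimately show ?thesis by simp
    next
      case 2
      have jV: "j \<in> V"
      proof (rule ccontr)
        assume "j \<notin> V"
        then have "{i, j} \<inter> V = {i}" using 2 by blast
        have "G {i}" using FG(2) unfolding \<open>{i, j} \<inter> V = {i}\<close> .
        then show False using V(1) 2 by simp
      qed
      have "F (A \<inter> U)"
      proof (rule ccontr)
        assume "\<not> F (A \<inter> U)"
        then obtain k where "k \<in> A" "k \<in> U" "\<not> F {k}"
          using balancedD(3)[OF F, of "A \<inter> U"] by blast
        then show False using onlyU[of k] 2 disj by blast
      qed
      moreover have ijV: "{i, j} \<inter> V = {i, j}" using 2 jV by blast
      moreover have "G (A \<inter> V)"
        by (rule balancedD(5)[OF G Int_lower2 _ _ FG(2)[unfolded ijV] V(1)[OF 2] V(2)[OF jV]])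
          (use ij 2 in simp, use ij jV in simp, rule onlyV, simp_all)
      ultimately show ?thesis by simp
    qed
    then show "F (A \<inter> U)" "G (A \<inter> V)" by auto
  qed
qed

section \<open>Strings as indicators of sets of positions\<close>

lemma indicator_string_nth [simp]:
  "length (indicator_string n A) = n" "k < n \<Longrightarrow> indicator_string n A ! k \<longleftrightarrow> k \<in> A"
  by (auto simp: indicator_string_def)

lemma indicator_string_in_strings [simp]: "indicator_string n A \<in> strings n"
  by (simp add: strings_def)

lemma indicator_string_eq_iff:
  "indicator_string n A = indicator_string n B \<longleftrightarrow> A \<inter> {..<n} = B \<inter> {..<n}"
  by (auto simp: list_eq_iff_nth_eq)

lemma zero_string_conv_indicator: "zero_string n = indicator_string n {}"
  by (rule nth_equalityI) (auto simp: zero_string_def)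

lemma string_conv_indicator: "s \<in> strings n \<Longrightarrow> s = indicator_string n {l. l < n \<and> s ! l}"
  by (rule nth_equalityI) (auto simp: strings_def)

lemma perm_string_indicator:
  assumes "\<sigma> permutes {..<n}" "A \<subseteq> {..<n}"
  shows "perm_string \<sigma> (indicator_string n A) = indicator_string n (\<sigma> ` A)"
proof (rule nth_equalityI)
  fix k assume "k < length (perm_string \<sigma> (indicator_string n A))"
  then have k: "k < n" by (simp add: perm_string_def)
  then have "inv \<sigma> k < n"
    using permutes_in_image[OF permutes_inv[OF assms(1)], of k] by simp
  moreover have "inv \<sigma> k \<in> A \<longleftrightarrow> k \<in> \<sigma> ` A"
    using permutes_inverses[OF assms(1)] by (metis image_iff)
  ultimately show "perm_string \<sigma> (indicator_string n A) ! k = indicator_string n (\<sigma> ` A) ! k"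
    using k by (simp add: perm_string_def permute_list_def)
qed (simp add: perm_string_def)

lemma take_drop_indicator_string:
  "take m (indicator_string (m + n) A) = indicator_string m A"
  "drop m (indicator_string (m + n) A) = indicator_string n {l. m + l \<in> A}"
  by (rule nth_equalityI; simp)+

text \<open>Agreement is asked for on subsets of \<open>U\<close> only, because an indicator string
  sees just the part of \<open>A\<close> below \<open>n\<close>. For the complement this matters: a
  nonempty \<open>A\<close> outside \<open>{..<n}\<close> also indicates the zero string.\<close>

lemma balanced_cong:
  assumes F: "balanced U F" and eq: "\<And>A. A \<subseteq> U \<Longrightarrow> G A \<longleftrightarrow> F A"
  shows "balanced U G"
proof -
  have one: "G {k} \<longleftrightarrow> F {k}" if "k \<in> A" "A \<subseteq> U" for A k
    by (rule eq) (use that in blast)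
  have two: "G {k, l} \<longleftrightarrow> F {k, l}" if "k \<in> A" "l \<in> A" "A \<subseteq> U" for A k l
    by (rule eq) (use that in blast)
  show ?thesis
    unfolding balanced_def
  proof (intro conjI allI ballI impI)
    show "G {}" using balancedD(1)[OF F] eq by simp
  next
    fix A assume A: "A \<subseteq> U" and "G A \<and> A \<noteq> {}"
    then obtain j where "j \<in> A" "F {j}" using balancedD(2)[OF F A] eq[OF A] by blast
    then show "\<exists>j\<in>A. G {j}" using one[OF _ A] by blast
  next
    fix A assume A: "A \<subseteq> U" and "\<not> G A"
    then obtain i where "i \<in> A" "\<not> F {i}" using balancedD(3)[OF F A] eq[OF A] by blast
    then show "\<exists>i\<in>A. \<not> G {i}" using one[OF _ A] by blast
  next
    fix A i j assume A: "A \<subseteq> U" "i \<in> A" "j \<in> A"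
      and *: "G A \<and> \<not> G {i} \<and> G {j} \<and> (\<forall>k\<in>A. G {k} \<longrightarrow> k = j)"
    have "F A" "\<not> F {i}" "F {j}" using * eq[OF A(1)] one[OF A(2,1)] one[OF A(3,1)] by simp_all
    moreover have "k = j" if "k \<in> A" "F {k}" for k
      using * that one[OF that(1) A(1)] by blast
    ultimately have "F {i, j}" by (rule balancedD(4)[OF F A])
    then show "G {i, j}" using two[OF A(2,3,1)] by simp
  next
    fix A i j assume A: "A \<subseteq> U" "i \<in> A" "j \<in> A"
      and *: "G {i, j} \<and> \<not> G {i} \<and> G {j} \<and> (\<forall>k\<in>A. \<not> G {k} \<longrightarrow> k = i)"
    have "F {i, j}" "\<not> F {i}" "F {j}"
      using * two[OF A(2,3,1)] one[OF A(2,1)] one[OF A(3,1)] by simp_all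
    moreover have "k = i" if "k \<in> A" "\<not> F {k}" for k
      using * that one[OF that(1) A(1)] by blast
    ultimately have "F A" by (rule balancedD(5)[OF F A])
    then show "G A" using eq[OF A(1)] by simp
  qed
qed

lemma type_fun_balanced:
  assumes "type_fun n f"
  shows "balanced {..<n} (\<lambda>A. f (indicator_string n A))"
  using assms
proof induction
  case one
  show ?case by (auto simp: balanced_def one_fun_def)
next
  case (compl n f)
  show ?case
    using balanced_compl[OF compl.IH]
    by (rule balanced_cong)
      (auto simp: compl_fun_def zero_string_conv_indicator indicator_string_eq_iff Int_absorb2)
next
  case (perm n f \<sigma>)
  have "balanced {..<n} (\<lambda>A. f (indicator_string n (\<sigma> ` A)))"
    using permutes_image[OF perm.hyps(2)]
    by (intro balanced_image[OF perm.IH]) auto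
  then show ?case
    by (rule balanced_cong) (simp add: perm_string_indicator[OF perm.hyps(2)])
next
  case (tensor m f n g)
  \<comment> \<open>The second factor occupies the positions from \<open>m\<close> on. The
    intersection comes before the shift because truncated subtraction would send every position
    below \<open>m\<close> to 0.\<close>
  have img: "(\<lambda>l. l - m) ` (A \<inter> {m..<m + n}) = {l. m + l \<in> A} \<inter> {..<n}" for A
  proof (intro set_eqI iffI)
    fix l assume "l \<in> {l. m + l \<in> A} \<inter> {..<n}"
    then have "m + l \<in> A \<inter> {m..<m + n}" "l = (m + l) - m" by auto
    then show "l \<in> (\<lambda>l. l - m) ` (A \<inter> {m..<m + n})" by (rule rev_image_eqI)
  qed auto
  have "balanced {m..<m + n} (\<lambda>A. g (indicator_string n ((\<lambda>l. l - m) ` A)))"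
    by (rule balanced_image[OF tensor.IH(2)]) auto
  from balanced_conj[OF tensor.IH(1) this]
  have "balanced {..<m + n} (\<lambda>A. f (indicator_string m (A \<inter> {..<m})) \<and>
      g (indicator_string n ((\<lambda>l. l - m) ` (A \<inter> {m..<m + n}))))"
    by (simp add: ivl_disj_un_one(2) ivl_disj_int_one(2))
  moreover have "indicator_string m (A \<inter> {..<m}) = indicator_string m A"
    "indicator_string n ((\<lambda>l. l - m) ` (A \<inter> {m..<m + n})) = indicator_string n {l. m + l \<in> A}" for A
    by (simp_all add: img indicator_string_eq_iff)
  ultimately show ?case
    by (simp add: tensor_fun_def take_drop_indicator_string)
qed

text \<open>All generators share the output set \<open>Out\<close>, so "output" can now be said
  without reference to \<open>f\<close>. For a join, one of the two functions is 1 at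
  \<open>s\<close> and its value at the pair carries over; for a meet, both are. The case of type
  functions is the second and fourth clause of \<open>balanced\<close>.\<close>

lemma regular_subtypes_string:
  assumes "f \<in> regular_subtypes n Out" "f s"
  shows "(s \<noteq> zero_string n \<longrightarrow> {k \<in> Out. s ! k} \<noteq> {}) \<and>
    (i < n \<and> i \<notin> Out \<and> s ! i \<and> {k \<in> Out. s ! k} = {j} \<longrightarrow> f (indicator_string n {i, j}))"
  using assms
proof (induction)
  case (type f)
  then have tf: "type_fun n f" and out: "k < n \<Longrightarrow> f (indicator_string n {k}) \<longleftrightarrow> k \<in> Out"
    and sub: "Out \<subseteq> {..<n}" for k
    by (auto simp: type_funs_with_outputs_def output_set_def)
  define A where "A = {l. l < n \<and> s ! l}"
  have s: "s = indicator_string n A"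
    using type_fun_in_bool_funs[OF tf] type.prems
    by (auto simp: bool_funs_def A_def intro: string_conv_indicator)
  have A: "A \<subseteq> {..<n}" by (auto simp: A_def)
  have fA: "f (indicator_string n A)" using type.prems s by simp
  note b = type_fun_balanced[OF tf]
  have "{k \<in> Out. s ! k} \<noteq> {}" if "s \<noteq> zero_string n"
  proof -
    have "A \<noteq> {}" using that s zero_string_conv_indicator by auto
    then obtain j where "j \<in> A" "f (indicator_string n {j})"
      using balancedD(2)[OF b A fA] by blast
    then show ?thesis using out[of j] by (auto simp: A_def)
  qed
  moreover have "f (indicator_string n {i, j})"
    if i: "i < n" "i \<notin> Out" "s ! i" and "{k \<in> Out. s ! k} = {j}"
  proof -
    from that have j: "j \<in> Out" "s ! j" and only: "k \<in> Out \<Longrightarrow> s ! k \<Longrightarrow> k = j" for k by blast+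
    show ?thesis
    proof (rule balancedD(4)[OF b A _ _ fA])
      show "i \<in> A" "j \<in> A" using i j sub by (auto simp: A_def)
      show "\<not> f (indicator_string n {i})" using out[of i] i by blast
      show "f (indicator_string n {j})" using out[of j] j sub by blast
      show "k = j" if "k \<in> A" "f (indicator_string n {k})" for k
        using that out[of k] only[of k] by (simp add: A_def)
    qed
  qed
  ultimately show ?case by blast
next
  case (join f g)
  then have "f s \<or> g s" by simp
  then show ?case using join.IH by auto
next
  case (meet f g)
  then have "f s" "g s" by simp_all
  then show ?case using meet.IH by auto
qed

section \<open>Positive matrices and channels\<close>

lemma sum_oper_apply: "(\<Sum>k\<in>A. X k) a b = (\<Sum>k\<in>A. (X k :: oper) a b)"
  by (induction A rule: infinite_finite_induct) auto

lemma finite_basis [simp]: "finite T \<Longrightarrow> finite (basis d T)"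
  by (simp add: basis_def finite_PiE)

lemma restrict_in_basis: "a \<in> basis d U \<Longrightarrow> T \<subseteq> U \<Longrightarrow> restrict a T \<in> basis d T"
  by (auto simp: basis_def)

lemma basis_restrict_eq: "a \<in> basis d T \<Longrightarrow> restrict a T = a"
  by (auto simp: basis_def)

lemma basis_fun_upd: "a \<in> basis d T \<Longrightarrow> l \<in> T \<Longrightarrow> x < d l \<Longrightarrow> a(l := x) \<in> basis d T"
  by (auto simp: basis_def PiE_def Pi_def extensional_def)

lemma merge_in_basis:
  "T \<inter> U = {} \<Longrightarrow> a \<in> basis d T \<Longrightarrow> c \<in> basis d U \<Longrightarrow> merge T U (a, c) \<in> basis d (T \<union> U)"
  by (auto simp: basis_def)

lemma basis_eqI:
  "a \<in> basis d (T \<union> U) \<Longrightarrow> b \<in> basis d (T \<union> U) \<Longrightarrow> restrict a T = restrict b T \<Longrightarrow>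
    restrict a U = restrict b U \<Longrightarrow> a = b"
  by (rule PiE_ext[of _ "T \<union> U"]) (auto simp: basis_def restrict_def fun_eq_iff; metis)+

lemma sum_basis_merge:
  assumes "T \<inter> U = {}"
  shows "(\<Sum>x\<in>basis d (T \<union> U). g x) = (\<Sum>a\<in>basis d T. \<Sum>c\<in>basis d U. g (merge T U (a, c)))"
proof -
  have "(\<Sum>x\<in>basis d (T \<union> U). g x) = (\<Sum>p\<in>basis d T \<times> basis d U. g (merge T U p))"
  proof (rule sum.reindex_bij_witness[where i = "merge T U" and j = "\<lambda>x. (restrict x T, restrict x U)"])
    fix x assume x: "x \<in> basis d (T \<union> U)"
    then show eq: "merge T U (restrict x T, restrict x U) = x"
      by (auto simp: merge_def basis_def PiE_def extensional_def fun_eq_iff)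
    show "(restrict x T, restrict x U) \<in> basis d T \<times> basis d U"
      using x by (auto intro: restrict_in_basis)
    show "g (merge T U (restrict x T, restrict x U)) = g x" by (simp only: eq)
  next
    fix p assume "p \<in> basis d T \<times> basis d U"
    then show "(restrict (merge T U p) T, restrict (merge T U p) U) = p"
      "merge T U p \<in> basis d (T \<union> U)"
      using assms by (auto simp: merge_in_basis basis_restrict_eq)
  qed
  then show ?thesis by (simp add: sum.cartesian_product split_def)
qed

section \<open>Positive semidefinite matrices\<close>

lemma psdI:
  assumes "\<And>v. (\<Sum>x\<in>A. \<Sum>y\<in>A. cnj (v x) * K x y * v y) \<in> \<real>"
    and "\<And>v. 0 \<le> Re (\<Sum>x\<in>A. \<Sum>y\<in>A. cnj (v x) * K x y * v y)"
  shows "psd A K"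
  using assms by (simp add: psd_def Let_def)

lemma psdD:
  assumes "psd A K"
  shows "(\<Sum>x\<in>A. \<Sum>y\<in>A. cnj (v x) * K x y * v y) \<in> \<real>"
    and "0 \<le> Re (\<Sum>x\<in>A. \<Sum>y\<in>A. cnj (v x) * K x y * v y)"
  using assms unfolding psd_def Let_def by blast+

lemma psd_cong:
  assumes "\<And>x y. x \<in> A \<Longrightarrow> y \<in> A \<Longrightarrow> K x y = L x y"
  shows "psd A K \<longleftrightarrow> psd A L"
proof -
  have "(\<Sum>x\<in>A. \<Sum>y\<in>A. cnj (v x) * K x y * v y) = (\<Sum>x\<in>A. \<Sum>y\<in>A. cnj (v x) * L x y * v y)" for v
    by (intro sum.cong refl) (simp add: assms)
  then show ?thesis by (simp add: psd_def)
qed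

lemma psd_add:
  assumes "psd A K" "psd A L"
  shows "psd A (\<lambda>x y. K x y + L x y)"
proof -
  have "(\<Sum>x\<in>A. \<Sum>y\<in>A. cnj (v x) * (K x y + L x y) * v y) =
    (\<Sum>x\<in>A. \<Sum>y\<in>A. cnj (v x) * K x y * v y) + (\<Sum>x\<in>A. \<Sum>y\<in>A. cnj (v x) * L x y * v y)" for v
    by (simp add: algebra_simps sum.distrib)
  then show ?thesis
    using psdD[OF assms(1)] psdD[OF assms(2)] by (intro psdI) simp_all
qed

lemma psd_sum:
  assumes "\<And>i. i \<in> I \<Longrightarrow> psd A (K i)"
  shows "psd A (\<lambda>x y. \<Sum>i\<in>I. K i x y)"
  using assms
proof (induction I rule: infinite_finite_induct)
  case (insert i I)
  then show ?case by (simp add: psd_add)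
qed (simp_all add: psd_def)

lemma psd_scale:
  assumes "psd A K" "0 \<le> (r :: real)"
  shows "psd A (\<lambda>x y. of_real r * K x y)"
proof -
  have "(\<Sum>x\<in>A. \<Sum>y\<in>A. cnj (v x) * (of_real r * K x y) * v y) =
    of_real r * (\<Sum>x\<in>A. \<Sum>y\<in>A. cnj (v x) * K x y * v y)" for v
    by (simp add: sum_distrib_left ac_simps)
  then show ?thesis
    using psdD[OF assms(1)] assms(2) by (intro psdI) simp_all
qed

text \<open>A vector \<open>v\<close> on \<open>B\<close> is transported along \<open>h\<close> to a
  vector \<open>w\<close> on \<open>A\<close> that vanishes off the image; by injectivity the two
  quadratic forms agree. Together with sums and nonnegative multiples this yields complete
  positivity of every concrete map below, each being a sum of compressions or embeddings of the
  matrix.\<close>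

lemma psd_pullback:
  assumes K: "psd A K" and fin: "finite A" "finite B"
    and h: "h ` {x \<in> B. P x} \<subseteq> A" "inj_on h {x \<in> B. P x}"
  shows "psd B (\<lambda>x y. if P x \<and> P y then K (h x) (h y) else 0)"
proof -
  let ?S = "{x \<in> B. P x}"
  have quad: "\<exists>w. (\<Sum>x\<in>B. \<Sum>y\<in>B. cnj (v x) * (if P x \<and> P y then K (h x) (h y) else 0) * v y) =
    (\<Sum>x\<in>A. \<Sum>y\<in>A. cnj (w x) * K x y * w y)" for v
  proof
    define w where "w u = (if u \<in> h ` ?S then v (the_inv_into ?S h u) else 0)" for u
    have w: "w (h x) = v x" if "x \<in> ?S" for x
      using that by (simp add: w_def the_inv_into_f_f[OF h(2)])
    have "(\<Sum>x\<in>A. \<Sum>y\<in>A. cnj (w x) * K x y * w y) =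
        (\<Sum>x\<in>h ` ?S. \<Sum>y\<in>A. cnj (w x) * K x y * w y)"
      using h(1) fin by (intro sum.mono_neutral_right) (auto simp: w_def)
    also have "\<dots> = (\<Sum>x\<in>h ` ?S. \<Sum>y\<in>h ` ?S. cnj (w x) * K x y * w y)"
      using h(1) fin by (intro sum.cong refl sum.mono_neutral_right) (auto simp: w_def)
    also have "\<dots> = (\<Sum>x\<in>?S. \<Sum>y\<in>?S. cnj (w (h x)) * K (h x) (h y) * w (h y))"
      by (simp only: sum.reindex[OF h(2)] o_def)
    also have "\<dots> = (\<Sum>x\<in>?S. \<Sum>y\<in>?S. cnj (v x) * K (h x) (h y) * v y)"
      by (intro sum.cong refl) (simp only: w)
    also have "\<dots> = (\<Sum>x\<in>?S. \<Sum>y\<in>B. cnj (v x) * (if P y then K (h x) (h y) else 0) * v y)"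
      using fin by (intro sum.cong refl sum.mono_neutral_cong_left) auto
    also have "\<dots> = (\<Sum>x\<in>B. \<Sum>y\<in>B. cnj (v x) * (if P x \<and> P y then K (h x) (h y) else 0) * v y)"
      using fin by (intro sum.mono_neutral_cong_left) auto
    finally show "(\<Sum>x\<in>B. \<Sum>y\<in>B. cnj (v x) * (if P x \<and> P y then K (h x) (h y) else 0) * v y) =
      (\<Sum>x\<in>A. \<Sum>y\<in>A. cnj (w x) * K x y * w y)" by simp
  qed
  show ?thesis
  proof (rule psdI)
    fix v
    from quad[of v] obtain w where
      w: "(\<Sum>x\<in>B. \<Sum>y\<in>B. cnj (v x) * (if P x \<and> P y then K (h x) (h y) else 0) * v y) =
        (\<Sum>x\<in>A. \<Sum>y\<in>A. cnj (w x) * K x y * w y)" ..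
    show "(\<Sum>x\<in>B. \<Sum>y\<in>B. cnj (v x) * (if P x \<and> P y then K (h x) (h y) else 0) * v y) \<in> \<real>"
      "0 \<le> Re (\<Sum>x\<in>B. \<Sum>y\<in>B. cnj (v x) * (if P x \<and> P y then K (h x) (h y) else 0) * v y)"
      unfolding w by (rule psdD[OF K])+
  qed
qed

lemma psd_diagonal:
  assumes "finite A" "\<And>x. x \<in> A \<Longrightarrow> 0 \<le> (g x :: real)"
  shows "psd A (\<lambda>x y. if x = y then of_real (g x) else 0)"
proof -
  have "(\<Sum>x\<in>A. \<Sum>y\<in>A. cnj (v x) * (if x = y then of_real (g x) else 0) * v y) =
    of_real (\<Sum>x\<in>A. g x * (cmod (v x))\<^sup>2)" for v
  proof -
    have "(\<Sum>y\<in>A. cnj (v x) * (if x = y then of_real (g x) else 0) * v y) =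
      of_real (g x * (cmod (v x))\<^sup>2)" if "x \<in> A" for x
    proof -
      have "(\<Sum>y\<in>A. cnj (v x) * (if x = y then of_real (g x) else 0) * v y) =
        (\<Sum>y\<in>A. if x = y then cnj (v x) * of_real (g x) * v y else 0)"
        by (intro sum.cong) auto
      also have "\<dots> = of_real (g x) * (v x * cnj (v x))" using assms(1) that by simp
      finally show ?thesis by (simp only: complex_norm_square of_real_mult)
    qed
    then show ?thesis by simp
  qed
  then show ?thesis
    using assms(2) by (intro psdI) (simp_all add: sum_nonneg)
qed

section \<open>Choi operators and elementary channels\<close>

lemma ketbra_in_opers: "k \<in> basis d T \<Longrightarrow> l \<in> basis d T \<Longrightarrow> ketbra k l \<in> opers d T"
  by (auto simp: ketbra_def opers_def)

text \<open>The matrix unit in each summand selects a single pair \<open>k\<close>,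
  \<open>l\<close>. Entries of a Choi operator thereby become entries of \<open>\<Phi>\<close> on
  matrix units, the form in which all later computations take place.\<close>

lemma choi_apply:
  assumes "finite T"
  shows "choi d T U \<Phi> a b = (if a \<in> basis d (T \<union> U) \<and> b \<in> basis d (T \<union> U)
    then \<Phi> (ketbra (restrict a T) (restrict b T)) (restrict a U) (restrict b U) else 0)"
proof (cases "a \<in> basis d (T \<union> U) \<and> b \<in> basis d (T \<union> U)")
  case True
  then have r: "restrict a T \<in> basis d T" "restrict b T \<in> basis d T"
    by (auto intro: restrict_in_basis)
  have "choi d T U \<Phi> a b = (\<Sum>k\<in>basis d T. \<Sum>l\<in>basis d T.
    if l = restrict b T then if k = restrict a T then \<Phi> (ketbra k l) (restrict a U) (restrict b U) else 0 else 0)"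
    using True by (auto simp: choi_def sum_oper_apply tensor_def ketbra_def intro!: sum.cong)
  also have "\<dots> = \<Phi> (ketbra (restrict a T) (restrict b T)) (restrict a U) (restrict b U)"
    using assms r by simp
  finally show ?thesis using True by simp
next
  case False
  then show ?thesis by (auto simp: choi_def sum_oper_apply tensor_def)
qed

lemma trace_choi:
  assumes "finite T" "T \<inter> U = {}" "trace_preserving d T U \<Phi>"
  shows "trace d (T \<union> U) (choi d T U \<Phi>) = of_nat (\<Prod>i\<in>T. d i)"
proof -
  have "trace d (T \<union> U) (choi d T U \<Phi>) =
    (\<Sum>a\<in>basis d T. \<Sum>c\<in>basis d U. choi d T U \<Phi> (merge T U (a, c)) (merge T U (a, c)))"
    by (simp add: trace_def sum_basis_merge[OF assms(2)])
  also have "\<dots> = (\<Sum>a\<in>basis d T. trace d U (\<Phi> (ketbra a a)))"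
    using assms by (simp add: trace_def choi_apply merge_in_basis basis_restrict_eq)
  also have "\<dots> = (\<Sum>a\<in>basis d T. trace d T (ketbra a a))"
    using assms(3) by (intro sum.cong refl) (simp add: trace_preserving_def ketbra_in_opers)
  also have "\<dots> = (\<Sum>a\<in>basis d T. 1)"
    using assms(1) by (intro sum.cong refl) (simp add: trace_def ketbra_def)
  also have "\<dots> = of_nat (\<Prod>i\<in>T. d i)"
    using assms(1) by (simp add: basis_def card_PiE)
  finally show ?thesis .
qed

lemma completely_positiveD:
  fixes k :: nat
  assumes "completely_positive d T U \<Phi>" "\<forall>p<k. \<forall>q<k. X p q \<in> opers d T"
    and "psd ({..<k} \<times> basis d T) (\<lambda>(p, a) (q, b). X p q a b)"
  shows "psd ({..<k} \<times> basis d U) (\<lambda>(p, a) (q, b). \<Phi> (X p q) a b)"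
  using assms unfolding completely_positive_def by blast

lemma channel_comp:
  assumes "channel d T U \<Phi>" "channel d U V \<Psi>"
  shows "channel d T V (\<Psi> \<circ> \<Phi>)"
proof -
  have op: "\<Phi> X \<in> opers d U" if "X \<in> opers d T" for X
    using assms(1) that by (simp add: channel_def linear_map_def)
  have "linear_map d T V (\<Psi> \<circ> \<Phi>)"
    using assms op by (simp add: channel_def linear_map_def)
  moreover have "trace_preserving d T V (\<Psi> \<circ> \<Phi>)"
    using assms op by (simp add: channel_def trace_preserving_def)
  moreover have "completely_positive d T V (\<Psi> \<circ> \<Phi>)"
    unfolding completely_positive_def
  proof (intro allI impI, elim conjE)
    fix k :: nat and X :: "nat \<Rightarrow> nat \<Rightarrow> oper"
    assume X: "\<forall>p<k. \<forall>q<k. X p q \<in> opers d T"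
      and psd: "psd ({..<k} \<times> basis d T) (\<lambda>(p, a) (q, b). X p q a b)"
    have \<Phi>: "completely_positive d T U \<Phi>" and \<Psi>: "completely_positive d U V \<Psi>"
      using assms by (simp_all add: channel_def)
    have "\<forall>p<k. \<forall>q<k. \<Phi> (X p q) \<in> opers d U" using X op by blast
    from completely_positiveD[OF \<Psi> this completely_positiveD[OF \<Phi> X psd]]
    show "psd ({..<k} \<times> basis d V) (\<lambda>(p, a) (q, b). (\<Psi> \<circ> \<Phi>) (X p q) a b)" by simp
  qed
  ultimately show ?thesis by (simp add: channel_def)
qed

lemma channel_ptrace:
  assumes fin: "finite T" "finite U" and disj: "T \<inter> U = {}"
  shows "channel d (T \<union> U) T (ptrace d T U)"
proof -
  have "linear_map d (T \<union> U) T (ptrace d T U)"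
    by (auto simp: linear_map_def opers_def ptrace_def fun_eq_iff sum.distrib sum_distrib_left)
  moreover have "trace_preserving d (T \<union> U) T (ptrace d T U)"
    by (simp add: trace_preserving_def trace_def ptrace_def sum_basis_merge[OF disj])
  moreover have "completely_positive d (T \<union> U) T (ptrace d T U)"
    unfolding completely_positive_def
  proof (intro allI impI, elim conjE)
    fix k :: nat and X :: "nat \<Rightarrow> nat \<Rightarrow> oper"
    assume psd: "psd ({..<k} \<times> basis d (T \<union> U)) (\<lambda>(p, a) (q, b). X p q a b)"
    let ?h = "\<lambda>c (p, a). (p, merge T U (a, c))"
    have "a = a'" if "a \<in> basis d T" "a' \<in> basis d T" "merge T U (a, c) = merge T U (a', c)" for a a' c
      using that disj by (metis basis_restrict_eq restrict_merge(1))
    then have inj: "inj_on (?h c) ({..<k} \<times> basis d T)" for c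
      by (auto simp: inj_on_def)
    \<comment> \<open>Each basis vector \<open>c\<close> of the discarded system contributes the
      compression by its bra. The condition \<open>True \<and> True\<close> only gives the summand
      the shape of \<open>psd_pullback\<close>.\<close>
    have "psd ({..<k} \<times> basis d T) (\<lambda>x y. \<Sum>c\<in>basis d U.
        if True \<and> True then (\<lambda>(p, a) (q, b). X p q a b) (?h c x) (?h c y) else 0)"
      using fin inj disj
      by (intro psd_sum psd_pullback[OF psd]) (auto simp: merge_in_basis)
    then show "psd ({..<k} \<times> basis d T) (\<lambda>(p, a) (q, b). ptrace d T U (X p q) a b)"
      by (rule iffD1[OF psd_cong, rotated]) (auto simp: ptrace_def)
  qed
  ultimately show ?thesis by (simp add: channel_def)
qed

text \<open>The map $X \mapsto |0\rangle\langle 0|_{A_i} \otimes X$.\<close>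

definition fix_input :: "(nat \<Rightarrow> nat) \<Rightarrow> nat set \<Rightarrow> nat \<Rightarrow> oper \<Rightarrow> oper" where
  "fix_input d T i X = (\<lambda>a b. if a \<in> basis d T \<and> b \<in> basis d T \<and> a i = 0 \<and> b i = 0
     then X (restrict a (T - {i})) (restrict b (T - {i})) else 0)"

text \<open>Inserting the state 0 takes matrix units to matrix units. This is what links the Choi
  operator of the composite channel to entries of the Choi operator of
  \<open>\<Phi>\<close>.\<close>

lemma fix_input_ketbra:
  assumes "k \<in> basis d T" "l \<in> basis d T" "i \<in> T" "0 < d i"
  shows "fix_input d T i (ketbra (restrict k (T - {i})) (restrict l (T - {i}))) =
    ketbra (k(i := 0)) (l(i := 0))"
proof -
  have *: "a \<in> basis d T \<and> a i = 0 \<and> restrict a (T - {i}) = restrict k (T - {i}) \<longleftrightarrow> a = k(i := 0)"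
    if "k \<in> basis d T" for a k
  proof
    assume a: "a \<in> basis d T \<and> a i = 0 \<and> restrict a (T - {i}) = restrict k (T - {i})"
    show "a = k(i := 0)"
    proof
      fix l
      have "l \<in> T - {i} \<Longrightarrow> a l = k l" using a by (metis restrict_apply')
      then show "a l = (k(i := 0)) l"
        using a that assms(3) by (cases "l \<in> T") (auto simp: basis_def PiE_def extensional_def)
    qed
  next
    assume "a = k(i := 0)"
    then show "a \<in> basis d T \<and> a i = 0 \<and> restrict a (T - {i}) = restrict k (T - {i})"
      using that assms by (auto simp: basis_fun_upd)
  qed
  show ?thesis
  proof (intro ext)
    fix a b
    show "fix_input d T i (ketbra (restrict k (T - {i})) (restrict l (T - {i}))) a b =
      ketbra (k(i := 0)) (l(i := 0)) a b"
      unfolding fix_input_def ketbra_def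
      using *[OF assms(1), of a] *[OF assms(2), of b] by presburger
  qed
qed

lemma channel_fix_input:
  assumes fin: "finite T" and i: "i \<in> T" "0 < d i"
  shows "channel d (T - {i}) T (fix_input d T i)"
proof -
  \<comment> \<open>Used twice: as a reindexing of the diagonal sum it gives trace preservation, and
    its injectivity is what the pullback of positive matrices requires.\<close>
  have bij: "bij_betw (\<lambda>a. restrict a (T - {i})) {a \<in> basis d T. a i = 0} (basis d (T - {i}))"
  proof (rule bij_betw_byWitness[where f' = "\<lambda>a. a(i := 0)"])
    show "\<forall>a\<in>{a \<in> basis d T. a i = 0}. (restrict a (T - {i}))(i := 0) = a"
      using i by (auto simp: basis_def PiE_def extensional_def fun_eq_iff)
    show "\<forall>a\<in>basis d (T - {i}). restrict (a(i := 0)) (T - {i}) = a"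
      by (auto simp: basis_def PiE_def extensional_def fun_eq_iff)
    show "(\<lambda>a. restrict a (T - {i})) ` {a \<in> basis d T. a i = 0} \<subseteq> basis d (T - {i})"
      by (auto simp: restrict_in_basis)
    show "(\<lambda>a. a(i := 0)) ` basis d (T - {i}) \<subseteq> {a \<in> basis d T. a i = 0}"
      using i by (auto simp: basis_def PiE_def Pi_def extensional_def)
  qed
  have "linear_map d (T - {i}) T (fix_input d T i)"
    by (auto simp: linear_map_def opers_def fix_input_def fun_eq_iff)
  moreover have "trace_preserving d (T - {i}) T (fix_input d T i)"
    unfolding trace_preserving_def
  proof
    fix X
    have "trace d T (fix_input d T i X) =
      (\<Sum>a\<in>{a \<in> basis d T. a i = 0}. X (restrict a (T - {i})) (restrict a (T - {i})))"
      using fin unfolding trace_def fix_input_def by (intro sum.mono_neutral_cong_right) auto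
    also have "\<dots> = trace d (T - {i}) X"
      unfolding trace_def by (rule sum.reindex_bij_betw[OF bij])
    finally show "trace d T (fix_input d T i X) = trace d (T - {i}) X" .
  qed
  moreover have "completely_positive d (T - {i}) T (fix_input d T i)"
    unfolding completely_positive_def
  proof (intro allI impI, elim conjE)
    fix k :: nat and X :: "nat \<Rightarrow> nat \<Rightarrow> oper"
    assume psd: "psd ({..<k} \<times> basis d (T - {i})) (\<lambda>(p, a) (q, b). X p q a b)"
    let ?h = "\<lambda>(p, a). (p :: nat, restrict a (T - {i}))" and ?P = "\<lambda>(p :: nat, a). a i = (0 :: nat)"
    have "inj_on ?h {x \<in> {..<k} \<times> basis d T. ?P x}"
      using bij_betw_imp_inj_on[OF bij] unfolding inj_on_def by auto
    then have "psd ({..<k} \<times> basis d T)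
      (\<lambda>x y. if ?P x \<and> ?P y then (\<lambda>(p, a) (q, b). X p q a b) (?h x) (?h y) else 0)"
      using fin by (intro psd_pullback[OF psd]) (auto simp: restrict_in_basis)
    then show "psd ({..<k} \<times> basis d T) (\<lambda>(p, a) (q, b). fix_input d T i (X p q) a b)"
      by (rule iffD1[OF psd_cong, rotated]) (auto simp: fix_input_def)
  qed
  ultimately show ?thesis by (simp add: channel_def)
qed

section \<open>No signalling if the value at the pair is 0\<close>

text \<open>View \<open>M\<close> as a block matrix in the coordinate \<open>i\<close>. The
  assumption \<open>inv\<close> says that off-diagonal blocks vanish and all diagonal blocks equal
  the block at 0, which is the entrywise form of an identity on $A_i$ tensored with that block. It
  remains to recognise the block at 0 as the Choi operator of a channel.\<close>

lemma no_signalling_channelI: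
  assumes fin: "finite Inp" "finite Out" and disj: "Inp \<inter> Out = {}"
    and i: "i \<in> Inp" "0 < d i" and j: "j \<in> Out"
    and \<Phi>: "channel d Inp Out \<Phi>"
    and M: "M = ptrace d (Inp \<union> {j}) (Out - {j}) (choi d Inp Out \<Phi>)"
    and inv: "\<And>a b. a \<in> basis d (Inp \<union> {j}) \<Longrightarrow> b \<in> basis d (Inp \<union> {j}) \<Longrightarrow>
      M a b = (if a i = b i then M (a(i := 0)) (b(i := 0)) else 0)"
  shows "no_signalling_channel d Inp Out \<Phi> i j"
proof -
  \<comment> \<open>Read from the right: prepare $A_i$ in the state 0, apply \<open>\<Phi>\<close>,
    discard all outputs but \<open>j\<close>. Each stage is a channel, hence so is the
    composite.\<close>
  define \<Psi> where "\<Psi> = ptrace d {j} (Out - {j}) \<circ> (\<Phi> \<circ> fix_input d Inp i)"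
  have Out: "{j} \<union> (Out - {j}) = Out" using j by blast
  have \<Psi>: "channel d (Inp - {i}) {j} \<Psi>"
    unfolding \<Psi>_def
    using channel_ptrace[of "{j}" "Out - {j}" d, unfolded Out] fin i
    by (intro channel_comp[OF channel_comp[OF channel_fix_input \<Phi>]]) simp_all
  have ij: "i \<noteq> j" "j \<notin> Inp" using i j disj by blast+
  have U: "Inp \<union> {j} \<union> (Out - {j}) = Inp \<union> Out" using j by blast
  have V: "{i} \<union> (Inp - {i} \<union> {j}) = Inp \<union> {j}" using i by blast
  have disj': "(Inp \<union> {j}) \<inter> (Out - {j}) = {}" using disj by blast
  have M_apply: "M a b = (\<Sum>c\<in>basis d (Out - {j}). \<Phi> (ketbra (restrict a Inp) (restrict b Inp))
      (merge {j} (Out - {j}) (restrict a {j}, c)) (merge {j} (Out - {j}) (restrict b {j}, c)))"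
    if "a \<in> basis d (Inp \<union> {j})" "b \<in> basis d (Inp \<union> {j})" for a b
  proof -
    have mInp: "restrict (merge (Inp \<union> {j}) (Out - {j}) (a, c)) Inp = restrict a Inp" for a c :: mindex
      by (auto simp: merge_def fun_eq_iff)
    have mOut: "restrict (merge (Inp \<union> {j}) (Out - {j}) (a, c)) Out =
        merge {j} (Out - {j}) (restrict a {j}, c)" for a c :: mindex
      using disj j by (auto simp: merge_def fun_eq_iff)
    have "M a b = (\<Sum>c\<in>basis d (Out - {j}). choi d Inp Out \<Phi>
        (merge (Inp \<union> {j}) (Out - {j}) (a, c)) (merge (Inp \<union> {j}) (Out - {j}) (b, c)))"
      using that by (simp add: M ptrace_def)
    also have "\<dots> = (\<Sum>c\<in>basis d (Out - {j}). \<Phi> (ketbra (restrict a Inp) (restrict b Inp))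
      (merge {j} (Out - {j}) (restrict a {j}, c)) (merge {j} (Out - {j}) (restrict b {j}, c)))"
    proof (intro sum.cong refl)
      fix c assume c: "c \<in> basis d (Out - {j})"
      show "choi d Inp Out \<Phi>
          (merge (Inp \<union> {j}) (Out - {j}) (a, c)) (merge (Inp \<union> {j}) (Out - {j}) (b, c)) =
        \<Phi> (ketbra (restrict a Inp) (restrict b Inp))
          (merge {j} (Out - {j}) (restrict a {j}, c)) (merge {j} (Out - {j}) (restrict b {j}, c))"
        using merge_in_basis[OF disj' that(1) c] merge_in_basis[OF disj' that(2) c]
        unfolding choi_apply[OF fin(1)] U mInp mOut by (simp only: simp_thms if_True)
    qed
    finally show ?thesis .
  qed
  have "M = tensor d {i} ((Inp - {i}) \<union> {j}) (id_oper d {i}) (choi d (Inp - {i}) {j} \<Psi>)"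
  proof (intro ext)
    fix a b
    show "M a b = tensor d {i} ((Inp - {i}) \<union> {j}) (id_oper d {i}) (choi d (Inp - {i}) {j} \<Psi>) a b"
    proof (cases "a \<in> basis d (Inp \<union> {j}) \<and> b \<in> basis d (Inp \<union> {j})")
      case True
      let ?W = "Inp - {i} \<union> {j}"
      have r: "restrict a {i} = restrict b {i} \<longleftrightarrow> a i = b i"
        by (auto simp: fun_eq_iff)
      have ri: "restrict a {i} \<in> basis d {i}"
        using True i by (auto intro: restrict_in_basis)
      have rW: "restrict a ?W \<in> basis d ?W" "restrict b ?W \<in> basis d ?W"
        using True by (auto intro: restrict_in_basis)
      have upd: "a(i := 0) \<in> basis d (Inp \<union> {j})" "b(i := 0) \<in> basis d (Inp \<union> {j})"
        using True i by (auto intro: basis_fun_upd)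
      have rr: "restrict (restrict x ?W) (Inp - {i}) = restrict (restrict x Inp) (Inp - {i})"
        "restrict (restrict x ?W) {j} = restrict x {j}"
        "restrict (x(i := 0)) Inp = (restrict x Inp)(i := 0)"
        "restrict (x(i := 0)) {j} = restrict x {j}" for x :: mindex
        using i ij by (auto simp: fun_eq_iff)
      have rj: "restrict a {j} \<in> basis d {j}" "restrict b {j} \<in> basis d {j}"
        and rInp: "restrict a Inp \<in> basis d Inp" "restrict b Inp \<in> basis d Inp"
        using True by (auto intro: restrict_in_basis)
      have "choi d (Inp - {i}) {j} \<Psi> (restrict a ?W) (restrict b ?W) =
          \<Psi> (ketbra (restrict (restrict a Inp) (Inp - {i})) (restrict (restrict b Inp) (Inp - {i})))
            (restrict a {j}) (restrict b {j})"
        using rW fin by (simp only: choi_apply finite_Diff rr simp_thms if_True)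
      \<comment> \<open>With $A_i$ prepared in the state 0, the matrix unit fed to
        \<open>\<Phi>\<close> has both \<open>i\<close>-entries equal to 0, which singles out the
        block of \<open>M\<close> at 0.\<close>
      also have "\<dots> = M (a(i := 0)) (b(i := 0))"
        by (simp only: \<Psi>_def o_apply fix_input_ketbra[where d = d, OF rInp i] ptrace_def rj
            M_apply[OF upd] rr simp_thms if_True)
      finally show ?thesis
        using True ri inv[of a b] by (simp add: tensor_def V id_oper_def r insert_absorb i)
    next
      case False
      then show ?thesis by (auto simp: tensor_def V M ptrace_def insert_absorb i)
    qed
  qed
  then show ?thesis
    unfolding no_signalling_channel_def M using \<Psi> by blast
qed

section \<open>Partial traces of product operators\<close>

lemma tensor_family_apply:
  assumes "a \<in> basis d T" "b \<in> basis d T"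
  shows "tensor_family d T X a b = (\<Prod>l\<in>T. X l (restrict a {l}) (restrict b {l}))"
  using assms by (simp add: tensor_family_def)

lemma trace_singleton: "trace d {l} Y = (\<Sum>x<d l. Y (\<lambda>_\<in>{l}. x) (\<lambda>_\<in>{l}. x))"
  unfolding trace_def
proof (rule sum.reindex_bij_witness[where i = "\<lambda>x. \<lambda>_\<in>{l}. x" and j = "\<lambda>a. a l"])
  fix a assume a: "a \<in> basis d {l}"
  then show eq: "(\<lambda>_\<in>{l}. a l) = a"
    by (auto simp: basis_def PiE_def extensional_def fun_eq_iff)
  show "a l \<in> {..<d l}" using a by (auto simp: basis_def)
  show "Y (\<lambda>_\<in>{l}. a l) (\<lambda>_\<in>{l}. a l) = Y a a" by (simp only: eq)
qed (auto simp: basis_def)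

text \<open>The sum over multi-indices on \<open>U\<close> of a product over \<open>U\<close>
  factorises into local traces. One traceless factor in \<open>U\<close> therefore annihilates the
  whole product operator.\<close>

lemma ptrace_tensor_family:
  assumes fin: "finite T" "finite U" and disj: "T \<inter> U = {}"
  shows "ptrace d T U (tensor_family d (T \<union> U) X) =
    (\<lambda>a b. (\<Prod>l\<in>U. trace d {l} (X l)) * tensor_family d T X a b)"
proof (intro ext)
  fix a b
  show "ptrace d T U (tensor_family d (T \<union> U) X) a b =
    (\<Prod>l\<in>U. trace d {l} (X l)) * tensor_family d T X a b"
  proof (cases "a \<in> basis d T \<and> b \<in> basis d T")
    case True
    have mT: "restrict (merge T U (x, c)) {l} = restrict x {l}" if "l \<in> T" for l and x c :: mindex
      using that by (auto simp: merge_def fun_eq_iff)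
    have mU: "restrict (merge T U (x, c)) {l} = (\<lambda>_\<in>{l}. c l)" if "l \<in> U" for l and x c :: mindex
      using that disj by (auto simp: merge_def fun_eq_iff)
    have "ptrace d T U (tensor_family d (T \<union> U) X) a b =
      (\<Sum>c\<in>basis d U. (\<Prod>l\<in>U. X l (\<lambda>_\<in>{l}. c l) (\<lambda>_\<in>{l}. c l)) * tensor_family d T X a b)"
      using True disj fin
      by (auto simp: ptrace_def tensor_family_apply merge_in_basis prod.union_disjoint mT mU
          mult.commute intro!: sum.cong)
    also have "\<dots> = (\<Sum>c\<in>basis d U. (\<Prod>l\<in>U. X l (\<lambda>_\<in>{l}. c l) (\<lambda>_\<in>{l}. c l))) * tensor_family d T X a b"
      by (simp add: sum_distrib_right)
    also have "(\<Sum>c\<in>basis d U. (\<Prod>l\<in>U. X l (\<lambda>_\<in>{l}. c l) (\<lambda>_\<in>{l}. c l))) =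
        (\<Prod>l\<in>U. trace d {l} (X l))"
      using fin(2) unfolding trace_singleton basis_def by (subst prod_sum_PiE) auto
    finally show ?thesis .
  next
    case False
    then show ?thesis by (auto simp: ptrace_def tensor_family_def)
  qed
qed

lemma ptrace_fun_space_invariant:
  assumes d: "\<forall>l<n. 2 \<le> d l" and IO: "Inp \<union> Out = {..<n}" "Inp \<inter> Out = {}"
    and f: "f \<in> regular_subtypes n Out" and i: "i \<in> Inp" and j: "j \<in> Out"
    and nf: "\<not> f (indicator_string n {i, j})" and C: "C \<in> fun_space d n f"
    and a: "a \<in> basis d (Inp \<union> {j})" and b: "b \<in> basis d (Inp \<union> {j})"
  shows "ptrace d (Inp \<union> {j}) (Out - {j}) C a b =
    (if a i = b i then ptrace d (Inp \<union> {j}) (Out - {j}) C (a(i := 0)) (b(i := 0)) else 0)"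
proof -
  let ?V = "Inp \<union> {j}" and ?U = "Out - {j}"
  \<comment> \<open>For fixed \<open>a\<close> and \<open>b\<close> the claim is real-linear in the
    operator. Hence \<open>W\<close> is a real subspace, and spans and sums reduce the claim to the
    product operators generating each component.\<close>
  define W where "W = {Z. ptrace d ?V ?U Z a b =
    (if a i = b i then ptrace d ?V ?U Z (a(i := 0)) (b(i := 0)) else 0)}"
  have fin: "finite ?V" "finite ?U"
    using finite_subset[of Inp "{..<n}"] finite_subset[of Out "{..<n}"] IO(1) by auto
  have disj: "?V \<inter> ?U = {}" using IO by blast
  have VU: "?V \<union> ?U = {..<n}" using IO j by blast
  have "i < n" "i \<notin> Out" using i IO by blast+
  then have i': "i < n" "i \<notin> Out" "0 < d i" using d[rule_format, of i] by simp_all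
  have upd: "a(i := 0) \<in> basis d ?V" "b(i := 0) \<in> basis d ?V"
    using a b i i' by (auto intro: basis_fun_upd)
  have W: "oper.subspace W"
    unfolding oper.subspace_def
    by (auto simp: W_def ptrace_def oper_scaleR_def sum.distrib upd a b simp flip: sum_distrib_left)
  have prod: "tensor_family d {..<n} X \<in> W"
    if s: "s \<in> strings n" "f s" and X: "\<forall>l<n. X l \<in> local_space d l (s ! l)" for s X
  proof (cases "s ! i")
    \<comment> \<open>The factor at \<open>i\<close> is a real multiple of the identity and the
      remaining factors do not see the coordinate \<open>i\<close>, so resetting it to 0 changes
      nothing.\<close>
    case False
    then obtain r where r: "X i = oper_scaleR r (id_oper d {i})"
      using X[rule_format, of i] i' by (auto simp: local_space_def)
    have iV: "i \<in> ?V" using i by blast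
    let ?R = "\<lambda>x y. \<Prod>l\<in>?V - {i}. X l (restrict x {l}) (restrict y {l})"
    have split: "tensor_family d ?V X x y = (if x i = y i then of_real r else 0) * ?R x y"
      if "x \<in> basis d ?V" "y \<in> basis d ?V" for x y
    proof -
      have "restrict x {i} \<in> basis d {i}" using that i by (auto intro: restrict_in_basis)
      moreover have "restrict x {i} = restrict y {i} \<longleftrightarrow> x i = y i"
        by (auto simp: fun_eq_iff)
      ultimately have "X i (restrict x {i}) (restrict y {i}) = (if x i = y i then of_real r else 0)"
        by (simp add: r oper_scaleR_def id_oper_def)
      then show ?thesis
        unfolding tensor_family_apply[OF that] prod.remove[OF fin(1) iV] by (simp only:)
    qed
    have "?R (a(i := 0)) (b(i := 0)) = ?R a b"
    proof (intro prod.cong refl)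
      fix l assume "l \<in> ?V - {i}"
      then have "restrict (x(i := 0)) {l} = restrict x {l}" for x :: mindex
        by (auto simp: fun_eq_iff)
      then show "X l (restrict (a(i := 0)) {l}) (restrict (b(i := 0)) {l}) =
        X l (restrict a {l}) (restrict b {l})" by simp
    qed
    then show ?thesis
      unfolding W_def mem_Collect_eq ptrace_tensor_family[OF fin disj, unfolded VU]
        split[OF a b] split[OF upd] by simp
  next
    case True
    then have "s \<noteq> zero_string n" using i' by (auto simp: zero_string_def)
    \<comment> \<open>The outputs set in \<open>s\<close> are not none, since \<open>s\<close> is
      nonzero, and not just \<open>j\<close>, since \<open>f\<close> is 0 at the pair. So some
      discarded output \<open>l\<close> carries a traceless factor, and the partial trace
      vanishes.\<close>
    then have "{k \<in> Out. s ! k} \<noteq> {}" and "{k \<in> Out. s ! k} \<noteq> {j}"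
      using regular_subtypes_string[OF f s(2), of i j] i' True nf by auto
    then obtain l where l: "l \<in> Out" "s ! l" "l \<noteq> j" by blast
    then have "l < n" using IO by blast
    then have "trace d {l} (X l) = 0" using X[rule_format, of l] l by (auto simp: local_space_def)
    then have "(\<Prod>l\<in>?U. trace d {l} (X l)) = 0"
      using l fin by (intro prod_zero) auto
    then show ?thesis
      unfolding W_def mem_Collect_eq ptrace_tensor_family[OF fin disj, unfolded VU] by simp
  qed
  have "string_space d s \<subseteq> W" if "s \<in> strings n" "f s" for s
    unfolding string_space_def
    using prod[OF that] that by (intro oper.span_minimal W) (auto simp: strings_def)
  moreover obtain X where "C = (\<Sum>s | s \<in> strings n \<and> f s. X s)"
    and "\<forall>s. s \<in> strings n \<and> f s \<longrightarrow> X s \<in> string_space d s"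
    using C by (auto simp: fun_space_def)
  ultimately have "C \<in> W" by (auto intro!: oper.subspace_sum[OF W])
  then show ?thesis by (simp add: W_def)
qed

section \<open>Signalling if the value at the pair is 1\<close>

text \<open>The measure-and-prepare channel of the stochastic matrix \<open>w\<close>: measure in
  the product basis, then on outcome \<open>a\<close> prepare \<open>x\<close> with probability
  \<open>w a x\<close>.\<close>

definition classical_channel ::
    "(nat \<Rightarrow> nat) \<Rightarrow> nat set \<Rightarrow> nat set \<Rightarrow> (mindex \<Rightarrow> mindex \<Rightarrow> real) \<Rightarrow> oper \<Rightarrow> oper" where
  "classical_channel d T U w X = (\<lambda>x y. if x \<in> basis d U \<and> x = y
     then (\<Sum>a\<in>basis d T. of_real (w a x) * X a a) else 0)"

lemma channel_classical_channel:
  assumes fin: "finite T" "finite U"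
    and w: "\<And>a x. a \<in> basis d T \<Longrightarrow> x \<in> basis d U \<Longrightarrow> 0 \<le> w a x"
      "\<And>a. a \<in> basis d T \<Longrightarrow> (\<Sum>x\<in>basis d U. w a x) = 1"
  shows "channel d T U (classical_channel d T U w)"
proof -
  have "linear_map d T U (classical_channel d T U w)"
    unfolding linear_map_def
  proof (intro conjI ballI allI)
    show "classical_channel d T U w X \<in> opers d U" for X
      by (auto simp: opers_def classical_channel_def)
  qed (auto simp: classical_channel_def fun_eq_iff sum.distrib sum_distrib_left algebra_simps)
  moreover have "trace_preserving d T U (classical_channel d T U w)"
    unfolding trace_preserving_def
  proof
    fix X
    have "trace d U (classical_channel d T U w X) =
      (\<Sum>x\<in>basis d U. \<Sum>a\<in>basis d T. of_real (w a x) * X a a)"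
      by (simp add: trace_def classical_channel_def)
    also have "\<dots> = (\<Sum>a\<in>basis d T. of_real (\<Sum>x\<in>basis d U. w a x) * X a a)"
      by (subst sum.swap) (simp add: sum_distrib_right)
    also have "\<dots> = trace d T X"
      by (simp add: w(2) trace_def)
    finally show "trace d U (classical_channel d T U w X) = trace d T X" .
  qed
  moreover have "completely_positive d T U (classical_channel d T U w)"
    unfolding completely_positive_def
  proof (intro allI impI, elim conjE)
    fix k :: nat and X :: "nat \<Rightarrow> nat \<Rightarrow> oper"
    assume psd: "psd ({..<k} \<times> basis d T) (\<lambda>(p, a) (q, b). X p q a b)"
    let ?P = "\<lambda>x (p :: nat, y). y = (x :: mindex)" and ?h = "\<lambda>a (p :: nat, y :: mindex). (p, a :: mindex)"
    let ?B = "{..<k} \<times> basis d U"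
    \<comment> \<open>One term per pair of outcome \<open>a\<close> and prepared \<open>x\<close>,
      weighted by \<open>w a x\<close>: the entries at block indices \<open>(p, x)\<close> are
      copied from \<open>(p, a)\<close>, all others are 0.\<close>
    have "psd ?B (\<lambda>u v. of_real (w a x) * (if ?P x u \<and> ?P x v
          then (\<lambda>(p, a) (q, b). X p q a b) (?h a u) (?h a v) else 0))"
      if "a \<in> basis d T" "x \<in> basis d U" for a x
      using fin that by (intro psd_scale psd_pullback[OF psd] w(1)) (auto simp: inj_on_def)
    then have "psd ?B (\<lambda>u v. \<Sum>x\<in>basis d U. \<Sum>a\<in>basis d T. of_real (w a x) * (if ?P x u \<and> ?P x v
          then (\<lambda>(p, a) (q, b). X p q a b) (?h a u) (?h a v) else 0))"
      by (intro psd_sum)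
    then show "psd ?B (\<lambda>(p, a) (q, b). classical_channel d T U w (X p q) a b)"
    proof (rule iffD1[OF psd_cong, rotated])
      fix u v assume uv: "u \<in> ?B" "v \<in> ?B"
      obtain p y q z where eq: "u = (p, y)" "v = (q, z)" by (cases u, cases v)
      have "(\<Sum>x\<in>basis d U. \<Sum>a\<in>basis d T. of_real (w a x) * (if y = x \<and> z = x then X p q a a else 0)) =
          (\<Sum>x\<in>basis d U. if x = y then (\<Sum>a\<in>basis d T. of_real (w a x) * (if z = x then X p q a a else 0)) else 0)"
        by (intro sum.cong refl) auto
      also have "\<dots> = classical_channel d T U w (X p q) y z"
        using uv fin by (auto simp: classical_channel_def eq)
      finally show "(\<Sum>x\<in>basis d U. \<Sum>a\<in>basis d T. of_real (w a x) * (if ?P x u \<and> ?P x v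
          then (\<lambda>(p, a) (q, b). X p q a b) (?h a u) (?h a v) else 0)) =
        (\<lambda>(p, a) (q, b). classical_channel d T U w (X p q) a b) u v"
        unfolding eq prod.case .
    qed
  qed
  ultimately show ?thesis by (simp add: channel_def)
qed

lemma choi_classical_channel:
  assumes "finite T"
  shows "choi d T U (classical_channel d T U w) =
    (\<lambda>a b. if a = b then if a \<in> basis d (T \<union> U) then of_real (w (restrict a T) (restrict a U)) else 0 else 0)"
proof (intro ext)
  fix a b
  show "choi d T U (classical_channel d T U w) a b =
    (if a = b then if a \<in> basis d (T \<union> U) then of_real (w (restrict a T) (restrict a U)) else 0 else 0)"
  proof (cases "a \<in> basis d (T \<union> U) \<and> b \<in> basis d (T \<union> U)")
    case True
    then have r: "restrict a T \<in> basis d T" "restrict a U \<in> basis d U"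
      by (auto intro: restrict_in_basis)
    have "(\<Sum>k\<in>basis d T. complex_of_real (w k (restrict a U)) * ketbra (restrict a T) (restrict b T) k k) =
      (\<Sum>k\<in>basis d T. if k = restrict a T
         then if restrict a T = restrict b T then of_real (w k (restrict a U)) else 0 else 0)"
      by (intro sum.cong) (auto simp: ketbra_def)
    also have "\<dots> = (if restrict a T = restrict b T then of_real (w (restrict a T) (restrict a U)) else 0)"
      using r assms by simp
    finally show ?thesis
      using True r basis_eqI[of a d T U b]
      by (auto simp: choi_apply[OF assms] classical_channel_def)
  next
    case False
    then show ?thesis by (auto simp: choi_apply[OF assms])
  qed
qed

text \<open>Splitting off the coordinate \<open>j\<close> leaves the sum of \<open>z\<close> over
  one bit as a factor. It serves both for the trace of a single Pauli operator and for the row sums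
  of the stochastic matrix over all outputs.\<close>

lemma sum_basis_sign:
  fixes z :: "nat \<Rightarrow> real"
  assumes "finite T" "j \<in> T" and z: "z 0 + z (Suc 0) = 0"
  shows "(\<Sum>a\<in>basis (\<lambda>_. 2) T. z (a j)) = 0"
proof -
  have T: "{j} \<union> (T - {j}) = T" using assms by blast
  have "(\<Sum>a\<in>basis (\<lambda>_. 2) T. z (a j)) =
    (\<Sum>a\<in>basis (\<lambda>_. 2) {j}. \<Sum>c\<in>basis (\<lambda>_. 2) (T - {j}). z (a j))"
    using sum_basis_merge[where T = "{j}" and U = "T - {j}" and d = "\<lambda>_. 2" and g = "\<lambda>a. z (a j)"] unfolding T by simp
  also have "\<dots> = (\<Sum>a\<in>basis (\<lambda>_. 2) {j}. z (a j)) * card (basis (\<lambda>_. 2) (T - {j}))"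
    by (simp add: mult.commute[of "real _"] flip: sum_distrib_right)
  also have "(\<Sum>a\<in>basis (\<lambda>_. 2) {j}. z (a j)) = (\<Sum>x<2. z x)"
    using prod_sum_PiE[of "{j}" "\<lambda>_. {..<2}" "\<lambda>_. z"] by (simp add: basis_def)
  finally show ?thesis using z by (simp add: numeral_2_eq_2)
qed

section \<open>Pauli operators and diagonal product operators\<close>

definition sign_value :: "nat \<Rightarrow> real" where
  "sign_value x = (if x = 0 then 1 else -1)"

text \<open>The Pauli operator Z on qubit \<open>l\<close>, with \<open>sign_value\<close> giving
  its eigenvalues; being Hermitian and traceless it represents the bit 1 of a string.\<close>

definition sign_oper :: "nat \<Rightarrow> oper" where
  "sign_oper l = (\<lambda>a b. if a \<in> basis (\<lambda>_. 2) {l} \<and> a = b then of_real (sign_value (a l)) else 0)"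

lemma tensor_family_in_string_space:
  assumes "length s = n" "\<And>l. l < n \<Longrightarrow> X l \<in> local_space d l (s ! l)"
  shows "tensor_family d {..<n} X \<in> string_space d s"
  unfolding string_space_def using assms by (intro oper.span_base) auto

text \<open>Two distinct multi-indices differ in some coordinate, and there the diagonal factor
  contributes a zero.\<close>

lemma tensor_family_diagonal:
  assumes "finite T" "\<And>l a b. l \<in> T \<Longrightarrow> a \<in> basis d {l} \<Longrightarrow> b \<in> basis d {l} \<Longrightarrow>
      X l a b = (if a = b then of_real (x l (a l)) else 0)"
  shows "tensor_family d T X =
    (\<lambda>a b. if a \<in> basis d T \<and> a = b then of_real (\<Prod>l\<in>T. x l (a l)) else 0)"
proof (intro ext)
  fix a b
  show "tensor_family d T X a b = (if a \<in> basis d T \<and> a = b then of_real (\<Prod>l\<in>T. x l (a l)) else 0)"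
  proof (cases "a \<in> basis d T \<and> b \<in> basis d T")
    case True
    have r: "X l (restrict a {l}) (restrict b {l}) = (if a l = b l then of_real (x l (a l)) else 0)"
      if "l \<in> T" for l
    proof -
      have "restrict a {l} = restrict b {l} \<longleftrightarrow> a l = b l" by (auto simp: fun_eq_iff)
      moreover have "restrict a {l} \<in> basis d {l}" "restrict b {l} \<in> basis d {l}"
        using True that by (auto intro: restrict_in_basis)
      ultimately show ?thesis using assms(2)[OF that] by simp
    qed
    have eq: "tensor_family d T X a b = (\<Prod>l\<in>T. if a l = b l then of_real (x l (a l)) else 0)"
      using True r by (simp add: tensor_family_apply)
    show ?thesis
    proof (cases "a = b")
      case False
      then obtain l where "a l \<noteq> b l" "l \<in> T"
        using True by (metis PiE_ext basis_def)
      then have "(\<Prod>l\<in>T. if a l = b l then complex_of_real (x l (a l)) else 0) = 0"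
        using assms(1) by (intro prod_zero) auto
      then show ?thesis using eq False by simp
    qed (use eq True in simp)
  next
    case False
    then show ?thesis by (auto simp: tensor_family_def)
  qed
qed

lemma signalling_if_pair_value:
  assumes IO: "Inp \<union> Out = {..<n}" "Inp \<inter> Out = {}" and i: "i \<in> Inp" and j: "j \<in> Out"
    and f0: "f (zero_string n)" and fij: "f (indicator_string n {i, j})"
    and inp: "input_set n f = Inp"
  shows "\<not> no_signalling n Inp Out f i j"
proof
  let ?d = "\<lambda>_ :: nat. 2 :: nat" and ?V = "Inp \<union> {j}" and ?U = "Out - {j}"
  define c where "c = (1 / 2 :: real) ^ card Out"
  \<comment> \<open>The weight is \<open>2 * c\<close> when the bits \<open>a i\<close> and
    \<open>x j\<close> agree and 0 otherwise: output \<open>j\<close> copies input \<open>i\<close>,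
    the other outputs are uniformly random. A row sums to 1 because the sign term cancels and
    \<open>c\<close> is the inverse of the number of output strings.\<close>
  define w :: "mindex \<Rightarrow> mindex \<Rightarrow> real" where
    "w a x = c * (1 + sign_value (a i) * sign_value (x j))" for a x
  define \<Phi> where "\<Phi> = classical_channel ?d Inp Out w"
  define C where "C = choi ?d Inp Out \<Phi>"
  have fin: "finite Inp" "finite Out"
    using finite_subset[of Inp "{..<n}"] finite_subset[of Out "{..<n}"] IO(1) by auto
  have ij: "i < n" "j < n" "i \<noteq> j" using i j IO by auto
  have w_nonneg: "0 \<le> w a x" for a x by (simp add: w_def c_def sign_value_def)
  have "(\<Sum>x\<in>basis ?d Out. w a x) = 1" for a
  proof -
    have "(\<Sum>x\<in>basis ?d Out. w a x) = c * card (basis ?d Out) +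
        c * sign_value (a i) * (\<Sum>x\<in>basis ?d Out. sign_value (x j))"
      by (simp add: w_def algebra_simps sum.distrib sum_distrib_left)
    also have "(\<Sum>x\<in>basis ?d Out. sign_value (x j)) = 0"
      by (rule sum_basis_sign[OF fin(2) j]) (simp add: sign_value_def)
    also have "card (basis ?d Out) = 2 ^ card Out"
      using fin(2) by (simp add: basis_def card_PiE)
    finally show ?thesis by (simp add: c_def power_divide)
  qed
  then have \<Phi>: "channel ?d Inp Out \<Phi>"
    unfolding \<Phi>_def by (intro channel_classical_channel fin w_nonneg)
  have C: "C = (\<lambda>a b. if a = b then if a \<in> basis ?d {..<n}
      then of_real (c * (1 + sign_value (a i) * sign_value (a j))) else 0 else 0)"
    using i j by (simp add: C_def \<Phi>_def choi_classical_channel[OF fin(1)] IO(1) w_def fun_eq_iff)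
  have "C \<in> fun_space ?d n f"
  proof -
    let ?Id = "tensor_family ?d {..<n} (\<lambda>l. id_oper ?d {l})"
    let ?Z = "tensor_family ?d {..<n} (\<lambda>l. if l = i \<or> l = j then sign_oper l else id_oper ?d {l})"
    let ?e = "indicator_string n {i, j}"
    \<comment> \<open>The decomposition of \<open>C\<close> along strings: its identity part belongs
      to \<theta>, its ZZ part to $e^{i,j}$, and every other component is 0.\<close>
    define X where "X s = (if s = zero_string n then oper_scaleR c ?Id else 0) +
      (if s = ?e then oper_scaleR c ?Z else 0)" for s
    have e0: "zero_string n \<noteq> ?e"
      using ij unfolding zero_string_conv_indicator indicator_string_eq_iff by auto
    have id: "id_oper d {l} \<in> local_space d l False" for d l
      unfolding local_space_def by (auto simp: oper_scaleR_def intro!: range_eqI[of _ _ 1])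
    have sg: "sign_oper l \<in> local_space ?d l True" for l
    proof -
      have "trace ?d {l} (sign_oper l) = of_real (\<Sum>a\<in>basis ?d {l}. sign_value (a l))"
        by (simp add: trace_def sign_oper_def)
      also have "\<dots> = 0"
        by (subst sum_basis_sign) (auto simp: sign_value_def)
      finally show ?thesis
        by (auto simp: local_space_def sign_oper_def opers_def hermitian_def split: if_splits)
    qed
    have "?Id \<in> string_space ?d (zero_string n)"
      by (rule tensor_family_in_string_space) (simp_all add: zero_string_def id)
    moreover have "?Z \<in> string_space ?d ?e"
      by (rule tensor_family_in_string_space) (simp_all add: id sg)
    ultimately have "X s \<in> string_space ?d s" for s
      using e0 unfolding X_def string_space_def
      by (auto intro: oper.span_scale oper.span_zero)
    moreover have "C = (\<Sum>s | s \<in> strings n \<and> f s. X s)"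
    proof -
      have fs: "finite {s. s \<in> strings n \<and> f s}"
        using finite_lists_length_eq[of "UNIV :: bool set" n]
        by (auto simp: strings_def intro: finite_subset[rotated])
      have "(\<Sum>s | s \<in> strings n \<and> f s. X s) = oper_scaleR c ?Id + oper_scaleR c ?Z"
        unfolding X_def sum.distrib using fs f0 fij
        by (simp add: sum.delta strings_def zero_string_def)
      also have "?Id = (\<lambda>a b. if a \<in> basis ?d {..<n} \<and> a = b then of_real (\<Prod>l<n. 1) else 0)"
        by (rule tensor_family_diagonal) (auto simp: id_oper_def)
      also have "?Z = (\<lambda>a b. if a \<in> basis ?d {..<n} \<and> a = b
          then of_real (\<Prod>l<n. if l = i \<or> l = j then sign_value (a l) else 1) else 0)"
        by (rule tensor_family_diagonal) (auto simp: id_oper_def sign_oper_def)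
      also have "(\<lambda>a :: mindex. \<Prod>l<n. if l = i \<or> l = j then sign_value (a l) else 1) =
          (\<lambda>a. sign_value (a i) * sign_value (a j))"
      proof
        fix a :: mindex
        have "(\<Prod>l<n. if l = i \<or> l = j then sign_value (a l) else 1) = (\<Prod>l\<in>{i, j}. sign_value (a l))"
          using ij by (intro prod.mono_neutral_cong_right) auto
        then show "(\<Prod>l<n. if l = i \<or> l = j then sign_value (a l) else 1) =
          sign_value (a i) * sign_value (a j)" using ij by simp
      qed
      finally show ?thesis
        by (auto simp: C oper_scaleR_def fun_eq_iff algebra_simps)
    qed
    ultimately show ?thesis by (auto simp: fun_space_def)
  qed
  moreover have "psd (basis ?d {..<n}) C"
  proof (rule iffD1[OF psd_cong psd_diagonal])
    fix x y assume "x \<in> basis ?d {..<n}"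
    then show "(if x = y then of_real (c * (1 + sign_value (x i) * sign_value (x j))) else 0) = C x y"
      by (cases "x = y") (simp_all add: C)
  qed (auto simp: c_def sign_value_def)
  moreover have "trace ?d {..<n} C = of_nat (\<Prod>i\<in>input_set n f. ?d i)"
    using trace_choi[OF fin(1) IO(2), of ?d \<Phi>] \<Phi> by (simp add: channel_def C_def IO(1) inp)
  ultimately have T1: "C \<in> T1 ?d n f" by (simp add: T1_def)
  assume "no_signalling n Inp Out f i j"
  then have "no_signalling_channel ?d Inp Out \<Phi> i j"
    using \<Phi> T1 unfolding no_signalling_def C_def by (auto dest!: spec[of _ ?d])
  then obtain \<Phi>\<^sub>1 where eq: "ptrace ?d ?V ?U C =
      tensor ?d {i} ((Inp - {i}) \<union> {j}) (id_oper ?d {i}) (choi ?d (Inp - {i}) {j} \<Phi>\<^sub>1)"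
    unfolding no_signalling_channel_def C_def by blast
  \<comment> \<open>Two diagonal positions that differ only in the bit \<open>i\<close>; an identity
    factor on $A_i$ would force equal entries there.\<close>
  define a0 :: mindex where "a0 = (\<lambda>l\<in>?V. 0)"
  define a1 where "a1 = a0(i := Suc 0)"
  have a: "a0 \<in> basis ?d ?V" "a1 \<in> basis ?d ?V"
    using i by (auto simp: a0_def a1_def basis_def PiE_def Pi_def extensional_def)
  have ai: "a0 i = 0" "a1 i = Suc 0" "a0 j = 0" "a1 j = 0"
    using ij i by (auto simp: a0_def a1_def)
  have disj: "?V \<inter> ?U = {}" and VU: "?V \<union> ?U = {..<n}" using IO j by auto
  have pt: "ptrace ?d ?V ?U C x x =
      of_real (\<Sum>u\<in>basis ?d ?U. c * (1 + sign_value (x i) * sign_value (x j)))"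
    if "x \<in> basis ?d ?V" for x
  proof -
    have "merge ?V ?U (x, u) i = x i" "merge ?V ?U (x, u) j = x j" for u :: mindex
      using i by (simp_all add: merge_def)
    moreover have "merge ?V ?U (x, u) \<in> basis ?d {..<n}" if "u \<in> basis ?d ?U" for u
      using merge_in_basis[OF disj \<open>x \<in> basis ?d ?V\<close> that] unfolding VU .
    ultimately show ?thesis
      using that unfolding ptrace_def C by simp
  qed
  have r1: "restrict a1 (Inp - {i} \<union> {j}) = restrict a0 (Inp - {i} \<union> {j})"
    using ij by (auto simp: a1_def fun_eq_iff)
  have V: "{i} \<union> (Inp - {i} \<union> {j}) = ?V" using i by blast
  have "restrict a0 {i} \<in> basis ?d {i}" "restrict a1 {i} \<in> basis ?d {i}"
    using a i by (auto intro: restrict_in_basis)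
  then have "ptrace ?d ?V ?U C a1 a1 = ptrace ?d ?V ?U C a0 a0"
    using a unfolding eq tensor_def V r1 id_oper_def by simp
  \<comment> \<open>At \<open>a1\<close> the signs are opposite and the entry is 0; at
    \<open>a0\<close> they agree and it is \<open>2 * c\<close> times the number of basis elements
    of the discarded outputs. That number is a power of 2, even when no output is discarded.\<close>
  then have "card (basis ?d ?U) = 0"
    using pt[OF a(1)] pt[OF a(2)] ai by (simp add: sign_value_def c_def)
  then show False
    using fin by (simp add: basis_def card_PiE)
qed

theorem theorem5p2:
  fixes n :: nat and Inp Out :: "nat set" and f :: bfun and i j :: nat
  assumes "n \<ge> 1"
    and "Inp \<union> Out = {..<n}" and "Inp \<inter> Out = {}"
    and "f \<in> regular_subtypes n Out"
    and "i \<in> Inp" and "j \<in> Out"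
  shows "no_signalling n Inp Out f i j \<longleftrightarrow> \<not> f (indicator_string n {i, j})"
proof
  have "f (zero_string n)" "input_set n f = Inp"
    using regular_subtypes_in_bool_funs[OF assms(4)] regular_subtypes_input_set[OF assms(4)] assms(2,3)
    by (auto simp: bool_funs_def)
  then show "no_signalling n Inp Out f i j \<Longrightarrow> \<not> f (indicator_string n {i, j})"
    using signalling_if_pair_value[OF assms(2,3,5,6)] by blast
next
  assume nf: "\<not> f (indicator_string n {i, j})"
  have fin: "finite Inp" "finite Out"
    using finite_subset[of Inp "{..<n}"] finite_subset[of Out "{..<n}"] assms(2) by auto
  show "no_signalling n Inp Out f i j"
    unfolding no_signalling_def
  proof (intro allI impI, elim conjE)
    fix d \<Phi>
    assume d: "\<forall>l<n. 2 \<le> d l" and \<Phi>: "channel d Inp Out \<Phi>" and "choi d Inp Out \<Phi> \<in> T1 d n f"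
    then have "choi d Inp Out \<Phi> \<in> fun_space d n f" by (simp add: T1_def)
    note inv = ptrace_fun_space_invariant[OF d assms(2-6) nf this]
    have "i < n" using assms(2,5) by blast
    \<comment> \<open>This guarantees that $A_i$ has the basis state 0 used to build the reduced
      channel.\<close>
    then have "0 < d i" using d[rule_format, of i] by simp
    then show "no_signalling_channel d Inp Out \<Phi> i j"
      using no_signalling_channelI[OF fin assms(3,5) _ assms(6) \<Phi> refl] inv by blast
  qed
qed

end
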